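(* Let $1\le p,q\le\infty$. Let $E_1=\ell_p^{(2)}(\ell_q^{(2)})$ and define recursively $E_{n+1}=\ell_p^{(2)}(\ell_q^{(2)}(E_n))$ for $n\ge 1$. Then for every $1<s<\infty$ and every $n\ge 1$, $$C_s(E_n)\ \ge\ S(E_n)\ \ge\ c(p,q)^n ,$$ where $S(E_n)$ is computed with respect to the canonical basis of $E_n$. In particular, if $p\neq q$ (in which case $c(p,q)>1$), then $C_s(E_n)$ grows at least exponentially in $n$.
   Context: Banach spaces are over $\mathbb R$ or $\mathbb C$, and scalar-valued functions take values in the corresponding field. **UMD constant.** For a Banach space $X$ and $1<s<\infty$, $C_s(X)\in[0,\infty]$ is the best constant $C$ such that $\sup_{\varepsilon_k\in\{-1,1\}}\|\sum_{k=0}^n\varepsilon_k\,df_k\|_{L_s(X)}\le C\|\sum_{k=0}^n df_k\|_{L_s(X)}$ for all $n\ge 0$ and all $X$-valued martingale difference sequences $(df_k)_{k=0}^n$ in $L_s(X)$ (on any filtered probability space); $C_s(X)=\infty$ if no such $C$ exists. **The constant $S$.** For a Banach space $X$ and a family $\{x_i\}_{i\in I}$ in $X$, $S(X)=S(X;\{x_i\})\in[0,\infty]$ is the best constant $C$ such that $$\Big\|\sum_{k=0}^N\mathbb E^{\mathcal A_k}(\theta_k)\,x_{i_k}\Big\|_{L_1(\Omega,\mathbb P;X)}\le C\Big\|\sum_{k=0}^N\theta_k\,x_{i_k}\Big\|_{L_\infty(\Omega,\mathbb P;X)}$$ for every $N\in\mathbb N$, every probability space $(\Omega,\mathcal F,\mathbb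 P)$ with filtration $\mathcal A_0\subset\mathcal A_1\subset\cdots\subset\mathcal F$, all distinct indices $i_0,\dots,i_N\in I$ and all $\theta_0,\dots,\theta_N\in L_\infty(\Omega,\mathcal F,\mathbb P)$ (here $\mathbb E^{\mathcal A_k}$ is conditional expectation); $S=\infty$ if no such constant exists. **The spaces.** For $1\le r\le\infty$ and a Banach space $F$, $\ell_r^{(2)}(F)$ is $F\times F$ with norm $\|(x_1,x_2)\|=\|(\|x_1\|,\|x_2\|)\|_{\ell_r}$, and $\ell_r^{(2)}$ is the 2-dimensional $\ell_r$ space. The canonical basis of $E_n$ (of cardinality $4^n$) consists of the tensor products of canonical basis vectors of the successive $\ell_p^{(2)}$, $\ell_q^{(2)}$ factors. **The constant $c(p,q)$.** Let $D=\{-1,1\}$ and $\mu=\frac12\delta_{-1}+\frac12\delta_1$. Then $c(p,q)$ is the operator norm of the projection $P:L_p(\mu;\ell_q^{(2)})\to L_p(\mu;\ell_q^{(2)})$, $P(f,g)=(\mathbb E f,g)$, where $\mathbb E f=\int f\,d\mu$ is regarded as a constant function. *)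

theory Defs
  imports "HOL-Probability.Probability" "HOL-Analysis.Finite_Function_Topology"
begin

section \<open>A separable normed type for the spaces $E_n$\<close>

text \<open>
  The Bochner integral of HOL-Analysis requires a second countable normed type. All spaces $E_n$
  are realised below as subspaces of one type of finitely supported functions.
\<close>

instance poly_mapping :: (countable, "{real_normed_vector, second_countable_topology}")
    second_countable_topology
proof
  let ?mk = "\<lambda>l :: ('a \<times> 'b) list. \<Sum>(a, b)\<leftarrow>l. Poly_Mapping.single a b"
  obtain D :: "'b set" where D: "countable D" "\<And>X. open X \<Longrightarrow> X \<noteq> {} \<Longrightarrow> \<exists>d\<in>D. d \<in> X"
    using countable_dense_exists by blast
  define Q where "Q = ?mk ` lists (UNIV \<times> D)"
  define B where "B = (\<lambda>(d, n). ball d (1 / real (Suc n))) ` (Q \<times> (UNIV :: nat set))"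
  have cB: "countable B"
    unfolding B_def Q_def using D(1) by (intro countable_image countable_SIGMA countable_lists) auto
  have dense: "\<exists>d\<in>Q. dist x d < e" if "e > 0" for x :: "'a \<Rightarrow>\<^sub>0 'b" and e
  proof -
    define r where "r = e / (real (card (Poly_Mapping.keys x)) + 1)"
    have r: "r > 0" using that by (simp add: r_def)
    have "\<forall>k. \<exists>c. c \<in> D \<and> dist (Poly_Mapping.lookup x k) c < r"
    proof
      fix k
      have "ball (Poly_Mapping.lookup x k) r \<noteq> {}" using r by simp
      from D(2)[OF open_ball this] show "\<exists>c. c \<in> D \<and> dist (Poly_Mapping.lookup x k) c < r"
        by auto
    qed
    from choice[OF this] obtain d
      where d': "\<forall>k. d k \<in> D \<and> dist (Poly_Mapping.lookup x k) (d k) < r" ..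
    have d: "d k \<in> D" "dist (Poly_Mapping.lookup x k) (d k) < r" for k
      using spec[OF d', of k] by simp_all
    have "finite (Poly_Mapping.keys x)" by (rule finite_keys)
    from finite_distinct_list[OF this] obtain ks
      where ks: "set ks = Poly_Mapping.keys x" "distinct ks" by (elim exE conjE)
    let ?y = "?mk (map (\<lambda>k. (k, d k)) ks)"
    have y: "?y = (\<Sum>k\<in>Poly_Mapping.keys x. Poly_Mapping.single k (d k))"
      using ks by (simp add: sum_list_distinct_conv_sum_set comp_def)
    have x: "x = (\<Sum>k\<in>Poly_Mapping.keys x. Poly_Mapping.single k (Poly_Mapping.lookup x k))"
      by (rule poly_mapping_eqI)
         (simp add: lookup_sum lookup_single when_def in_keys_iff)
    have ns: "norm (Poly_Mapping.single k c) = norm c" for k :: 'a and c :: 'b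
      by (cases "c = 0") (simp_all add: norm_poly_mapping_def dist_poly_mapping_def)
    have "dist x ?y = norm (\<Sum>k\<in>Poly_Mapping.keys x. Poly_Mapping.single k (Poly_Mapping.lookup x k - d k))"
      unfolding dist_norm y by (subst x) (simp add: sum_subtractf single_diff)
    also have "\<dots> \<le> (\<Sum>k\<in>Poly_Mapping.keys x. r)"
      using d(2) by (intro sum_norm_le) (simp add: ns dist_norm less_imp_le)
    also have "\<dots> < e" using that by (simp add: r_def field_simps)
    finally have "dist x ?y < e" .
    moreover have "?y \<in> Q" unfolding Q_def using d(1) by (intro imageI) auto
    ultimately show ?thesis by blast
  qed
  have "topological_basis B"
  proof (rule topological_basisI)
    fix U :: "('a \<Rightarrow>\<^sub>0 'b) set" and x assume U: "open U" "x \<in> U"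
    then obtain e where e: "e > 0" "ball x e \<subseteq> U" using openE by blast
    obtain n where n: "1 / real (Suc n) < e / 2"
      using e(1) nat_approx_posE[of "e / 2"] by auto
    obtain z where z: "z \<in> Q" "dist x z < 1 / real (Suc n)" using dense[of "1 / real (Suc n)" x] by auto
    have "ball z (1 / real (Suc n)) \<subseteq> ball x e"
    proof
      fix y assume "y \<in> ball z (1 / real (Suc n))"
      then show "y \<in> ball x e" using dist_triangle[of x y z] z(2) n by auto
    qed
    then show "\<exists>b\<in>B. x \<in> b \<and> b \<subseteq> U"
      using z e by (intro bexI[of _ "ball z (1 / real (Suc n))"]) (auto simp: B_def dist_commute)
  qed (auto simp: B_def)
  then show "\<exists>B :: ('a \<Rightarrow>\<^sub>0 'b) set set. countable B \<and> open = generate_topology B"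
    using cB topological_basis_imp_subbasis by blast
qed

section \<open>Probabilistic notions\<close>

text \<open>The norm of $L_p(M)$ for $1 \le p \le \infty$, with values in $[0,\infty]$. A vector-valued
  function is measured by applying this to its pointwise norm.\<close>

definition Lnorm :: "'w measure \<Rightarrow> ennreal \<Rightarrow> ('w \<Rightarrow> real) \<Rightarrow> ennreal" where
  "Lnorm M p h =
     (if p = \<infinity> then esssup M (\<lambda>w. ennreal \<bar>h w\<bar>)
      else let I = (\<integral>\<^sup>+ w. ennreal (\<bar>h w\<bar> powr enn2real p) \<partial>M)
           in if I = \<infinity> then \<infinity> else ennreal (enn2real I powr (1 / enn2real p)))"

definition filtered_prob_space :: "'w measure \<Rightarrow> (nat \<Rightarrow> 'w measure) \<Rightarrow> bool" where
  "filtered_prob_space M F \<longleftrightarrow>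
     prob_space M \<and> filtration (space M) F \<and> (\<forall>k. subalgebra M (F k))"

text \<open>\<open>g\<close> is a version of the conditional expectation of \<open>f\<close> given the sub-sigma-algebra \<open>F\<close>;
  \<^const>\<open>real_cond_exp\<close> covers only real-valued functions.\<close>

definition is_cond_exp ::
    "'w measure \<Rightarrow> 'w measure \<Rightarrow> ('w \<Rightarrow> 'b::{real_normed_vector, second_countable_topology})
      \<Rightarrow> ('w \<Rightarrow> 'b) \<Rightarrow> bool" where
  "is_cond_exp M F f g \<longleftrightarrow>
     integrable M f \<and> integrable M g \<and> g \<in> borel_measurable F \<and>
     (\<forall>A\<in>sets F. set_lebesgue_integral M A f = set_lebesgue_integral M A g)"

section \<open>The constants \<open>C\<^sub>s(X)\<close> and \<open>S(X)\<close>\<close>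

text \<open>
  Since the dimension of $E_n$ varies with $n$ inside the statement, a Banach space $X$ is given
  as a closed subspace \<open>V\<close> of a normed type together with a complete norm \<open>N\<close> on \<open>V\<close> that is equivalent to
  the restriction of the norm of the type. Equivalent norms have the same Borel sets and the same
  Bochner integral, so measurability and integration are those of the type, and only the sizes
  are measured with \<open>N\<close>.

  HOL cannot quantify over all types inside a definition, so the probability spaces range over all
  measures (with arbitrary sigma-algebras) on a type \<open>'w\<close>, which is a parameter of the constants.
  A statement about the constants for an arbitrary infinite \<open>'w\<close> covers every probability space,
  because a finite sample space embeds into an infinite type.

  As usual, the initial term $df_0 = f_0$ of a martingale difference sequence is only required to
  be measurable with respect to the initial sigma-algebra.
\<close>

definition mart_diff_seq ::
    "'v::{real_normed_vector, second_countable_topology} set \<Rightarrow> ('v \<Rightarrow> real) \<Rightarrow> real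
      \<Rightarrow> 'w measure \<Rightarrow> (nat \<Rightarrow> 'w measure) \<Rightarrow> nat \<Rightarrow> (nat \<Rightarrow> 'w \<Rightarrow> 'v) \<Rightarrow> bool" where
  "mart_diff_seq V N s M F n df \<longleftrightarrow>
     (\<forall>k\<le>n. df k \<in> borel_measurable (F k) \<and> (\<forall>w\<in>space M. df k w \<in> V) \<and>
             Lnorm M (ennreal s) (\<lambda>w. N (df k w)) < \<infinity>) \<and>
     (\<forall>k<n. is_cond_exp M (F k) (df (Suc k)) (\<lambda>_. 0))"

definition umd_const ::
    "'w itself \<Rightarrow> 'v::{real_normed_vector, second_countable_topology} set \<Rightarrow> ('v \<Rightarrow> real)
      \<Rightarrow> real \<Rightarrow> ennreal" where
  "umd_const _ V N s = Inf {ennreal C | C. 0 \<le> C \<and>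
     (\<forall>(M :: 'w measure) F n df. filtered_prob_space M F \<and> mart_diff_seq V N s M F n df \<longrightarrow>
        (SUP \<epsilon>\<in>UNIV \<rightarrow> {-1, 1}. Lnorm M (ennreal s) (\<lambda>w. N (\<Sum>k\<le>n. \<epsilon> k *\<^sub>R df k w)))
          \<le> ennreal C * Lnorm M (ennreal s) (\<lambda>w. N (\<Sum>k\<le>n. df k w)))}"

text \<open>\<open>act\<close> is the multiplication by scalars of the field \<open>'k\<close>; \<open>g k\<close> is a version of the
  conditional expectation of \<open>\<theta> k\<close> given \<open>A k\<close>.\<close>

definition S_const ::
    "'w itself \<Rightarrow> ('k::{real_normed_field, second_countable_topology} \<Rightarrow> 'v::real_normed_vector \<Rightarrow> 'v)
      \<Rightarrow> ('v \<Rightarrow> real) \<Rightarrow> 'i set \<Rightarrow> ('i \<Rightarrow> 'v) \<Rightarrow> ennreal" where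
  "S_const _ act N I x = Inf {ennreal C | C. 0 \<le> C \<and>
     (\<forall>(M :: 'w measure) A n i \<theta> g.
        filtered_prob_space M A \<and> inj_on i {..n} \<and> i ` {..n} \<subseteq> I \<and>
        (\<forall>k\<le>n. \<theta> k \<in> borel_measurable M \<and> Lnorm M \<infinity> (\<lambda>w. norm (\<theta> k w)) < \<infinity> \<and>
                is_cond_exp M (A k) (\<theta> k) (g k)) \<longrightarrow>
        Lnorm M 1 (\<lambda>w. N (\<Sum>k\<le>n. act (g k w) (x (i k))))
          \<le> ennreal C * Lnorm M \<infinity> (\<lambda>w. N (\<Sum>k\<le>n. act (\<theta> k w) (x (i k)))))}"

section \<open>The spaces $E_n$\<close>

text \<open>The norm of the pair of nonnegative reals $(a, b)$ in $\ell_r^{(2)}$.\<close>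

definition ell2 :: "ennreal \<Rightarrow> real \<Rightarrow> real \<Rightarrow> real" where
  "ell2 r a b = (if r = \<infinity> then max a b
     else (a powr enn2real r + b powr enn2real r) powr (1 / enn2real r))"

text \<open>
  $E_n$ consists of the functions on words of length $n$ over the four letters \<open>(a, b)\<close>. The head
  letter selects the coordinate \<open>a\<close> of the outermost $\ell_p^{(2)}$ factor and the coordinate \<open>b\<close>
  of the $\ell_q^{(2)}$ factor below it; the tail is the position in the remaining $E_{n-1}$.
  The recursion starts at the scalar field $E_0$, which gives $E_1 = \ell_p^{(2)}(\ell_q^{(2)})$.

  For the scalar field \<open>'k\<close>, the sort constraint \<open>{real_normed_field, euclidean_space}\<close> leaves exactly
  the real and the complex numbers.
\<close>

primrec E_norm_fun ::
    "ennreal \<Rightarrow> ennreal \<Rightarrow> nat \<Rightarrow> ((bool \<times> bool) list \<Rightarrow> 'k::real_normed_field) \<Rightarrow> real" where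
  "E_norm_fun p q 0 f = norm (f [])"
| "E_norm_fun p q (Suc n) f =
     ell2 p (ell2 q (E_norm_fun p q n (\<lambda>w. f ((False, False) # w)))
                    (E_norm_fun p q n (\<lambda>w. f ((False, True) # w))))
            (ell2 q (E_norm_fun p q n (\<lambda>w. f ((True, False) # w)))
                    (E_norm_fun p q n (\<lambda>w. f ((True, True) # w))))"

definition E_index :: "nat \<Rightarrow> (bool \<times> bool) list set" where
  "E_index n = {w. length w = n}"

definition E_space :: "nat \<Rightarrow> ((bool \<times> bool) list \<Rightarrow>\<^sub>0 'k::real_normed_field) set" where
  "E_space n = {x. Poly_Mapping.keys x \<subseteq> E_index n}"

definition E_norm ::
    "ennreal \<Rightarrow> ennreal \<Rightarrow> nat \<Rightarrow> ((bool \<times> bool) list \<Rightarrow>\<^sub>0 'k::real_normed_field) \<Rightarrow> real" where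
  "E_norm p q n x = E_norm_fun p q n (Poly_Mapping.lookup x)"

definition E_scale ::
    "'k::real_normed_field \<Rightarrow> ((bool \<times> bool) list \<Rightarrow>\<^sub>0 'k) \<Rightarrow> ((bool \<times> bool) list \<Rightarrow>\<^sub>0 'k)" where
  "E_scale c x = Poly_Mapping.map (\<lambda>a. c * a) x"

definition E_basis :: "(bool \<times> bool) list \<Rightarrow> ((bool \<times> bool) list \<Rightarrow>\<^sub>0 'k::real_normed_field)" where
  "E_basis w = Poly_Mapping.single w 1"

definition E_umd ::
    "'w itself \<Rightarrow> 'k::{real_normed_field, euclidean_space} itself
      \<Rightarrow> ennreal \<Rightarrow> ennreal \<Rightarrow> nat \<Rightarrow> real \<Rightarrow> ennreal" where
  "E_umd W _ p q n s =
     umd_const W (E_space n :: ((bool \<times> bool) list \<Rightarrow>\<^sub>0 'k) set) (E_norm p q n) s"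

definition E_S ::
    "'w itself \<Rightarrow> 'k::{real_normed_field, euclidean_space} itself
      \<Rightarrow> ennreal \<Rightarrow> ennreal \<Rightarrow> nat \<Rightarrow> ennreal" where
  "E_S W _ p q n =
     S_const W (E_scale :: 'k \<Rightarrow> _) (E_norm p q n) (E_index n) E_basis"

section \<open>The constant \<open>c(p, q)\<close>\<close>

abbreviation rademacher :: "real measure" where
  "rademacher \<equiv> uniform_count_measure {-1, 1}"

text \<open>Every pair of functions on the two-point space \<open>{-1, 1}\<close> belongs to
  $L_p(\mu; \ell_q^{(2)})$, so the operator norm is the best constant over all \<open>f\<close> and \<open>g\<close>.\<close>

definition c_const ::
    "'k::{real_normed_field, euclidean_space} itself \<Rightarrow> ennreal \<Rightarrow> ennreal \<Rightarrow> ennreal" where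
  "c_const _ p q = Inf {ennreal C | C. 0 \<le> C \<and>
     (\<forall>(f :: real \<Rightarrow> 'k) (g :: real \<Rightarrow> 'k).
        Lnorm rademacher p (\<lambda>t. ell2 q (norm (LINT u|rademacher. f u)) (norm (g t)))
          \<le> ennreal C * Lnorm rademacher p (\<lambda>t. ell2 q (norm (f t)) (norm (g t))))}"

end

theory Submission
  imports Defs
begin

text \<open>
  \<open>S \<ge> c(p,q)\<^sup>n\<close>: on a Bernoulli sample space, given \<open>(f, g)\<close> on the two-point space, a single random
  flip of the \<open>\<ell>\<^sub>p\<close> coordinate makes the \<open>E\<^sub>1\<close>-norm of the coefficients the constant \<open>\<parallel>(f, g)\<parallel>\<close>, and
  conditioning the \<open>f\<close> coefficients on nothing replaces \<open>f\<close> by its mean. In the inductive step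
  the coefficients under \<open>f\<close> and under \<open>g\<close> are multiplied with two independent copies of the
  previous construction, revealed one after the other with the flip in between, so that all the
  conditional expectations belong to a single filtration and both norms become \<open>n\<close>-th powers.

  \<open>C\<^sub>s \<ge> S\<close>: insert independent signs. The martingale of \<open>\<Sum> \<epsilon>\<^sub>k \<theta>\<^sub>k x\<^sub>k\<close> can be arranged so that every second
  increment is \<open>\<epsilon>\<^sub>k E(\<theta>\<^sub>k | A\<^sub>k) x\<^sub>k\<close>; the sum of these is the average of the martingale and a transform of
  it, and the signs disappear because the basis is 1-unconditional.
\<close>

section \<open>The norms of $E_n$\<close>

text \<open>The \<open>E_1\<close> norm itself supplies the L_p norm in \<open>c(p,q)\<close>: its
  two l_p coordinates carry the values at the two sample points, so after a random swap of them the
  norm no longer depends on the sample. Hence the L_1 norm on one side of S and the L_infinity norm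
  on the other cost nothing, and the powers are exact. Under iteration the obstacle is the
  filtration. With one shared copy of the previous construction, a coefficient under f would be
  conditioned on part of that copy but not on the flip, and one under g on the flip and possibly on
  a smaller part of the copy; such sigma-algebras need not be nested. The second copy removes the
  conflict: what is needed under f comes before the flip, what is needed under g comes after it. In
  the step from S to C_s no factor is lost either, because the martingale is its own transform by
  constant signs, so both terms of the average obey the UMD bound with the same C.\<close>

lemma enn2real_ge_1: "1 \<le> r \<Longrightarrow> r \<noteq> \<infinity> \<Longrightarrow> 1 \<le> enn2real r"
  by (metis enn2real_mono enn2real_1 infinity_ennreal_def top.not_eq_extremum)

lemma powr_convex_combination:
  fixes x y u v r :: real
  assumes r: "1 \<le> r" and x: "0 \<le> x" and y: "0 \<le> y" and u: "0 \<le> u" and v: "0 \<le> v" and uv: "u + v = 1"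
  shows "(u * x + v * y) powr r \<le> u * x powr r + v * y powr r"
proof -
  \<comment> \<open>If x or y is 0, the claim reduces to t^r \<le> t on [0,1]; convexity is then
    invoked only for positive arguments.\<close>
  have small: "(t * z) powr r \<le> t * z powr r" if "0 \<le> t" "t \<le> 1" "0 \<le> z" for t z :: real
  proof (cases "t = 0")
    case False
    then have "t powr r \<le> t powr 1" using that r by (intro powr_mono') auto
    then show ?thesis using that by (simp add: powr_mult mult_right_mono)
  qed simp
  show ?thesis
  proof (cases "x = 0 \<or> y = 0")
    case True
    then show ?thesis using small[of u x] small[of v y] assms by auto
  next
    case False
    then show ?thesis
      using convex_onD[OF powr_convex[OF r], of v x y] assms
      by (simp add: eq_diff_eq[symmetric, of u v 1])
  qed
qed

lemma ell2_nonneg: "0 \<le> a \<Longrightarrow> 0 \<le> b \<Longrightarrow> 0 \<le> ell2 r a b"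
  by (auto simp: ell2_def)

lemma ell2_mono:
  "0 \<le> a \<Longrightarrow> a \<le> a' \<Longrightarrow> 0 \<le> b \<Longrightarrow> b \<le> b' \<Longrightarrow> ell2 r a b \<le> ell2 r a' b'"
  by (auto simp: ell2_def intro!: powr_mono2 add_mono)

lemma ell2_commute: "ell2 r a b = ell2 r b a"
  by (simp add: ell2_def max.commute add.commute)

lemma ell2_powr:
  assumes "1 \<le> r" "r \<noteq> \<infinity>" "0 \<le> a" "0 \<le> b"
  shows "ell2 r a b powr enn2real r = a powr enn2real r + b powr enn2real r"
  using enn2real_ge_1[OF assms(1,2)] assms by (simp add: ell2_def powr_powr)

lemma ell2_le_iff:
  assumes "1 \<le> r" "r \<noteq> \<infinity>" "0 \<le> a" "0 \<le> b" "0 \<le> c"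
  shows "ell2 r a b \<le> c \<longleftrightarrow> a powr enn2real r + b powr enn2real r \<le> c powr enn2real r"
proof -
  have "0 < enn2real r" using enn2real_ge_1[OF assms(1,2)] by simp
  then show ?thesis
    unfolding ell2_powr[OF assms(1-4), symmetric]
    using powr_mono2[of "enn2real r" "ell2 r a b" c] powr_less_mono2[of "enn2real r" c "ell2 r a b"]
      ell2_nonneg[of a b r] assms by force
qed

lemma ell2_scale:
  assumes "1 \<le> r" "0 \<le> c" "0 \<le> a" "0 \<le> b"
  shows "ell2 r (c * a) (c * b) = c * ell2 r a b"
proof (cases "r = \<infinity>")
  case False
  then show ?thesis using enn2real_ge_1[OF assms(1) False] assms
    by (simp add: ell2_def powr_mult powr_powr flip: distrib_left)
qed (use assms in \<open>simp add: ell2_def max_mult_distrib_left\<close>)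

text \<open>Minkowski's inequality by normalisation: divided by their norms A and B both vectors
  become unit vectors, and their sum divided by A + B is the convex combination with weights A/(A+B)
  and B/(A+B). Convexity of the power is applied in each coordinate.\<close>

lemma ell2_triangle:
  assumes r: "1 \<le> r" and nn: "0 \<le> a" "0 \<le> b" "0 \<le> a'" "0 \<le> b'"
  shows "ell2 r (a + a') (b + b') \<le> ell2 r a b + ell2 r a' b'"
proof (cases "r = \<infinity>")
  case False
  define s where "s = enn2real r"
  define A B where "A = ell2 r a b" and "B = ell2 r a' b'"
  have s: "1 \<le> s" unfolding s_def using enn2real_ge_1[OF r False] .
  have A: "0 \<le> A" "A powr s = a powr s + b powr s" and B: "0 \<le> B" "B powr s = a' powr s + b' powr s"
    unfolding A_def B_def s_def using nn r False by (simp_all add: ell2_nonneg ell2_powr)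
  consider "A = 0" | "B = 0" | "A > 0" "B > 0" using A B by force
  then show ?thesis
  proof cases
    case 1
    then have "a powr s + b powr s = 0" using A s by simp
    then have "a = 0" "b = 0" by (simp_all add: add_nonneg_eq_0_iff)
    then show ?thesis using A by (simp add: A_def)
  next
    case 2
    then have "a' powr s + b' powr s = 0" using B s by simp
    then have "a' = 0" "b' = 0" by (simp_all add: add_nonneg_eq_0_iff)
    then show ?thesis using B by (simp add: B_def)
  next
    case 3
    define u v where "u = A / (A + B)" and "v = B / (A + B)"
    have uv: "0 \<le> u" "0 \<le> v" "u + v = 1"
      using 3 by (auto simp: u_def v_def simp flip: add_divide_distrib)
    have comb: "((x + x') / (A + B)) powr s \<le> u * (x powr s / A powr s) + v * (x' powr s / B powr s)"
      if "0 \<le> x" "0 \<le> x'" for x x'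
    proof -
      have "(x + x') / (A + B) = u * (x / A) + v * (x' / B)"
        using 3 by (simp add: u_def v_def add_divide_distrib)
      then show ?thesis
        using powr_convex_combination[OF s, of "x / A" "x' / B" u v] uv that 3
        by (simp add: powr_divide)
    qed
    have "((a + a') / (A + B)) powr s + ((b + b') / (A + B)) powr s
        \<le> u * ((a powr s + b powr s) / A powr s) + v * ((a' powr s + b' powr s) / B powr s)"
      using add_mono[OF comb[OF nn(1,3)] comb[OF nn(2,4)]] by (simp add: algebra_simps add_divide_distrib)
    also have "\<dots> = 1" using 3 uv by (simp add: A(2)[symmetric] B(2)[symmetric])
    finally have "(a + a') powr s + (b + b') powr s \<le> (A + B) powr s"
      using 3 nn by (simp add: powr_divide field_simps)
    then show ?thesis
      using ell2_le_iff[OF r False, of "a + a'" "b + b'" "A + B"] nn 3 by (simp add: A_def B_def s_def)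
  qed
qed (use nn in \<open>auto simp: ell2_def\<close>)

lemma borel_measurable_ell2 [measurable]:
  assumes [measurable]: "f \<in> borel_measurable M" "g \<in> borel_measurable M"
  shows "(\<lambda>x. ell2 r (f x) (g x)) \<in> borel_measurable M"
  unfolding ell2_def by (cases "r = \<infinity>") simp_all

lemma E_norm_fun_nonneg: "0 \<le> E_norm_fun p q n f"
  by (induction n arbitrary: f) (auto intro!: ell2_nonneg)

lemma E_norm_fun_mono:
  assumes "\<And>w. length w = n \<Longrightarrow> norm (f w) \<le> norm (g w)"
  shows "E_norm_fun p q n f \<le> E_norm_fun p q n g"
  using assms
proof (induction n arbitrary: f g)
  case (Suc n)
  then show ?case by (auto intro!: ell2_mono ell2_nonneg E_norm_fun_nonneg)
qed simp

text \<open>This is 1-unconditionality of the canonical basis. It removes random signs later, and it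
  lets functions be compared on words of length n only.\<close>

lemma E_norm_fun_cong_norm:
  assumes "\<And>w. length w = n \<Longrightarrow> norm (f w) = norm (g w)"
  shows "E_norm_fun p q n f = E_norm_fun p q n g"
  by (intro antisym E_norm_fun_mono) (simp_all add: assms)

lemma E_norm_fun_scale:
  assumes "1 \<le> p" "1 \<le> q"
  shows "E_norm_fun p q n (\<lambda>w. c * f w) = norm c * E_norm_fun p q n f"
  by (induction n arbitrary: f)
     (simp_all add: norm_mult ell2_scale[OF assms(1)] ell2_scale[OF assms(2)] ell2_nonneg E_norm_fun_nonneg)

lemma E_norm_fun_triangle:
  assumes "1 \<le> p" "1 \<le> q"
  shows "E_norm_fun p q n (\<lambda>w. f w + g w) \<le> E_norm_fun p q n f + E_norm_fun p q n g"
proof (induction n arbitrary: f g)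
  case (Suc n)
  let ?N = "E_norm_fun p q n"
  have q: "ell2 q (?N (\<lambda>w. f (u # w) + g (u # w))) (?N (\<lambda>w. f (v # w) + g (v # w)))
      \<le> ell2 q (?N (\<lambda>w. f (u # w))) (?N (\<lambda>w. f (v # w)))
        + ell2 q (?N (\<lambda>w. g (u # w))) (?N (\<lambda>w. g (v # w)))" for u v
    by (rule order_trans[OF ell2_mono ell2_triangle[OF assms(2)]]) (simp_all add: Suc E_norm_fun_nonneg)
  show ?case
    unfolding E_norm_fun.simps
    by (rule order_trans[OF ell2_mono ell2_triangle[OF assms(1)]])
       (simp_all add: q ell2_nonneg E_norm_fun_nonneg)
qed (simp add: norm_triangle_ineq)

lemma borel_measurable_E_norm_fun:
  assumes "\<And>w. length w = n \<Longrightarrow> (\<lambda>x. f x w) \<in> borel_measurable M"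
  shows "(\<lambda>x. E_norm_fun p q n (f x)) \<in> borel_measurable M"
  using assms
proof (induction n arbitrary: f)
  case (Suc n)
  then show ?case by simp
qed simp

lemma lookup_sum_single:
  assumes "finite I"
  shows "Poly_Mapping.lookup (\<Sum>i\<in>I. Poly_Mapping.single i (f i)) w = (if w \<in> I then f w else 0)"
  using assms by (simp add: lookup_sum lookup_single when_def)

lemma E_scale_basis: "E_scale c (E_basis w) = Poly_Mapping.single w c"
  by (rule poly_mapping_eqI) (simp add: E_scale_def E_basis_def map.rep_eq lookup_single when_def)

lemma finite_E_index: "finite (E_index n)"
  unfolding E_index_def using finite_lists_length_eq[of "UNIV :: (bool \<times> bool) set" n] by simp

section \<open>Transfer of the inequalities to other sample spaces\<close>

text \<open>The constants see only measures on \<open>'w\<close>, whereas the constructions live on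
  coin lists and on products with sign patterns. An injection \<open>h\<close> moves the sample
  space into \<open>'w\<close>; random variables move by composition with its inverse on the
  image.\<close>

lemma measurable_comp_the_inv_into:
  assumes "inj_on h (space M)" and "f \<in> measurable M N"
  shows "(\<lambda>z. f (the_inv_into (space M) h z)) \<in> measurable (embed_measure M h) N"
  using assms
  by (intro measurable_embed_measure1) (simp add: the_inv_into_f_f cong: measurable_cong)

lemma filtered_prob_space_embed_measure:
  assumes "filtered_prob_space M F" and inj: "inj_on h (space M)"
  shows "filtered_prob_space (embed_measure M h) (\<lambda>k. embed_measure (F k) h)"
proof -
  interpret prob_space M using assms by (simp add: filtered_prob_space_def)
  have F: "filtration (space M) F" "\<And>k. subalgebra M (F k)"
    using assms by (auto simp: filtered_prob_space_def)
  have sp: "space (F k) = space M" for k using F(2)[of k] by (simp add: subalgebra_def)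
  have "emeasure (embed_measure M h) (h ` space M) = 1"
    using emeasure_embed_measure_image'[OF inj sets.top] by (simp add: emeasure_space_1)
  then have "prob_space (embed_measure M h)"
    by (intro prob_spaceI) (simp add: space_embed_measure)
  moreover have "filtration (space (embed_measure M h)) (\<lambda>k. embed_measure (F k) h)"
    using filtration.sets_F_mono[OF F(1)]
    by (intro filtration.intro mono_embed_measure) (auto simp: space_embed_measure sp)
  moreover have "subalgebra (embed_measure M h) (embed_measure (F k) h)" for k
    using F(2)[of k] mono_embed_measure[of "F k" M h] unfolding subalgebra_def
    by (simp add: space_embed_measure)
  ultimately show ?thesis by (simp add: filtered_prob_space_def)
qed

lemma Lnorm_embed_measure:
  assumes inj: "inj_on h (space M)" and f [measurable]: "f \<in> borel_measurable M"
  shows "Lnorm (embed_measure M h) p (\<lambda>z. f (the_inv_into (space M) h z)) = Lnorm M p f"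
proof -
  let ?h' = "the_inv_into (space M) h"
  have m [measurable]: "(\<lambda>z. f (?h' z)) \<in> borel_measurable (embed_measure M h)"
    using measurable_comp_the_inv_into[OF inj f] .
  have "esssup (embed_measure M h) (\<lambda>z. ennreal \<bar>f (?h' z)\<bar>) = esssup M (\<lambda>z. ennreal \<bar>f z\<bar>)"
  proof -
    have "(AE x in M. ennreal \<bar>f (?h' (h x))\<bar> \<le> z) \<longleftrightarrow> (AE x in M. ennreal \<bar>f x\<bar> \<le> z)" for z
      using inj by (intro AE_cong) (simp add: the_inv_into_f_f)
    then show ?thesis
      by (simp add: esssup_eq_AE AE_embed_measure'[OF inj])
  qed
  moreover have "(\<integral>\<^sup>+ z. ennreal (\<bar>f (?h' z)\<bar> powr r) \<partial>embed_measure M h)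
      = (\<integral>\<^sup>+ x. ennreal (\<bar>f x\<bar> powr r) \<partial>M)" for r
    using inj by (subst nn_integral_embed_measure') (auto simp: the_inv_into_f_f intro!: nn_integral_cong)
  ultimately show ?thesis by (simp add: Lnorm_def)
qed

lemma is_cond_exp_embed_measure:
  fixes f g :: "'u \<Rightarrow> 'b::{banach, second_countable_topology}"
  assumes inj: "inj_on h (space M)" and sub: "subalgebra M F" and c: "is_cond_exp M F f g"
  shows "is_cond_exp (embed_measure M h) (embed_measure F h)
           (\<lambda>z. f (the_inv_into (space M) h z)) (\<lambda>z. g (the_inv_into (space M) h z))"
proof -
  let ?h' = "the_inv_into (space M) h"
  have sp: "space F = space M" using sub by (simp add: subalgebra_def)
  have [measurable]: "f \<in> borel_measurable M" "g \<in> borel_measurable M"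
    using c by (auto simp: is_cond_exp_def)
  have h [measurable]: "h \<in> measurable M (embed_measure M h)"
    using inj by (rule measurable_embed_measure2')
  have m [measurable]: "(\<lambda>z. u (?h' z)) \<in> borel_measurable (embed_measure M h)"
    if "u \<in> borel_measurable M" for u :: "'u \<Rightarrow> 'b"
    using measurable_comp_the_inv_into[OF inj that] .
  have int: "integrable (embed_measure M h) (\<lambda>z. u (?h' z))" if "integrable M u" for u :: "'u \<Rightarrow> 'b"
  proof -
    have "u \<in> borel_measurable M" using that by simp
    moreover have "integrable M (\<lambda>x. u (?h' (h x))) \<longleftrightarrow> integrable M u"
      using inj by (intro Bochner_Integration.integrable_cong refl) (simp add: the_inv_into_f_f)
    ultimately show ?thesis
      by (subst embed_measure_eq_distr'[OF inj], subst integrable_distr_eq) (use that in auto)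
  qed
  have set_int: "set_lebesgue_integral (embed_measure M h) (h ` B) (\<lambda>z. u (?h' z))
      = set_lebesgue_integral M B u" if u: "u \<in> borel_measurable M" and B: "B \<in> sets M" for u :: "'u \<Rightarrow> 'b" and B
  proof -
    have [measurable]: "h ` B \<in> sets (embed_measure M h)" using B by (rule in_sets_embed_measure)
    note [measurable] = m[OF u]
    have "set_lebesgue_integral (embed_measure M h) (h ` B) (\<lambda>z. u (?h' z))
        = (\<integral>x. indicator (h ` B) (h x) *\<^sub>R u (?h' (h x)) \<partial>M)"
      unfolding set_lebesgue_integral_def
      by (subst embed_measure_eq_distr'[OF inj], subst integral_distr) auto
    also have "\<dots> = set_lebesgue_integral M B u"
      unfolding set_lebesgue_integral_def
      using inj sets.sets_into_space[OF B]
      by (intro Bochner_Integration.integral_cong refl)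
         (auto simp: the_inv_into_f_f indicator_def inj_on_image_mem_iff[OF inj])
    finally show ?thesis .
  qed
  have "(\<lambda>z. g (?h' z)) \<in> borel_measurable (embed_measure F h)"
    using measurable_comp_the_inv_into[of h F g borel] inj c by (simp add: sp is_cond_exp_def)
  moreover have "set_lebesgue_integral (embed_measure M h) A (\<lambda>z. f (?h' z))
      = set_lebesgue_integral (embed_measure M h) A (\<lambda>z. g (?h' z))"
    if A: "A \<in> sets (embed_measure F h)" for A
  proof -
    obtain B where B: "A = h ` B" "B \<in> sets F"
      using A inj by (auto simp: sets_embed_measure' sp)
    then have "B \<in> sets M" using sub by (auto simp: subalgebra_def)
    then show ?thesis using c B by (simp add: set_int is_cond_exp_def)
  qed
  ultimately show ?thesis using c int by (simp add: is_cond_exp_def)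
qed

section \<open>Finitely supported functions treated by coordinates\<close>

lemma lookup_scaleR: "Poly_Mapping.lookup (r *\<^sub>R x) w = r *\<^sub>R Poly_Mapping.lookup x w"
proof -
  have "finite {i. r *\<^sub>R Poly_Mapping.lookup x i \<noteq> 0}"
    by (rule finite_subset[OF _ finite_keys[of x]]) (auto simp: in_keys_iff)
  then show ?thesis by (simp add: scaleR_poly_mapping_def)
qed

text \<open>The Bochner integral with values in the finitely supported functions must be taken
  coordinatewise, because this type is not complete.\<close>

lemma bounded_linear_single:
  "bounded_linear (Poly_Mapping.single w :: 'k \<Rightarrow> 'a \<Rightarrow>\<^sub>0 'k::real_normed_field)"
proof (rule bounded_linear_intro[where K = 1])
  show "norm (Poly_Mapping.single w x) \<le> norm x * 1" for x :: 'k
    by (cases "x = 0") (simp_all add: norm_poly_mapping_def dist_poly_mapping_def)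
  show "Poly_Mapping.single w (r *\<^sub>R x) = r *\<^sub>R Poly_Mapping.single w x" for r and x :: 'k
    by (rule poly_mapping_eqI) (simp add: lookup_single when_def lookup_scaleR)
qed (rule single_add)

lemma borel_measurable_sum_single:
  fixes d :: "'i::countable \<Rightarrow> 'x \<Rightarrow> 'k::{real_normed_field, euclidean_space}"
  assumes "\<And>w. w \<in> I \<Longrightarrow> d w \<in> borel_measurable M"
  shows "(\<lambda>x. \<Sum>w\<in>I. Poly_Mapping.single w (d w x)) \<in> borel_measurable M"
proof (rule borel_measurable_sum)
  fix w assume "w \<in> I"
  show "(\<lambda>x. Poly_Mapping.single w (d w x)) \<in> borel_measurable M"
    by (rule measurable_compose[OF assms[OF \<open>w \<in> I\<close>]])
       (intro borel_measurable_continuous_onI linear_continuous_on bounded_linear_single)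
qed

lemma is_cond_exp_sum_single:
  fixes d :: "'i::countable \<Rightarrow> 'x \<Rightarrow> 'k::{real_normed_field, euclidean_space}"
  assumes c: "\<And>w. w \<in> I \<Longrightarrow> is_cond_exp M F (d w) (\<lambda>_. 0)" and sub: "subalgebra M F"
  shows "is_cond_exp M F (\<lambda>x. \<Sum>w\<in>I. Poly_Mapping.single w (d w x)) (\<lambda>_. 0)"
proof -
  let ?f = "\<lambda>x. \<Sum>w\<in>I. Poly_Mapping.single w (d w x)"
  have int: "integrable M (d w)" if "w \<in> I" for w using c[OF that] by (simp add: is_cond_exp_def)
  have "integrable M ?f"
    by (rule Bochner_Integration.integrable_sum, rule integrable_bounded_linear[OF bounded_linear_single]) (rule int)
  moreover have "set_lebesgue_integral M A ?f = 0" if A: "A \<in> sets F" for A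
  proof -
    have AM: "A \<in> sets M" using A sub by (auto simp: subalgebra_def)
    have "has_bochner_integral M (\<lambda>x. \<Sum>w\<in>I. Poly_Mapping.single w (indicator A x *\<^sub>R d w x))
        (\<Sum>w\<in>I. Poly_Mapping.single w 0)"
    proof (rule has_bochner_integral_sum, rule has_bochner_integral_bounded_linear[OF bounded_linear_single])
      fix w assume w: "w \<in> I"
      then have "set_lebesgue_integral M A (d w) = 0"
        using c[OF w] A by (simp add: is_cond_exp_def set_lebesgue_integral_def)
      then show "has_bochner_integral M (\<lambda>x. indicator A x *\<^sub>R d w x) 0"
        using integrable_mult_indicator[OF AM int[OF w]]
        by (simp add: has_bochner_integral_iff set_lebesgue_integral_def)
    qed
    moreover have "(\<lambda>x. \<Sum>w\<in>I. Poly_Mapping.single w (indicator A x *\<^sub>R d w x)) = (\<lambda>x. indicator A x *\<^sub>R ?f x)"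
      by (simp add: scaleR_sum_right linear_cmul[OF bounded_linear.linear[OF bounded_linear_single]])
    ultimately show ?thesis
      by (simp add: set_lebesgue_integral_def has_bochner_integral_integral_eq)
  qed
  ultimately show ?thesis by (simp add: is_cond_exp_def set_lebesgue_integral_def)
qed

text \<open>Admissibility of a single constant, taken out of the infimum: lower bounds for the
  infimum are then proved from an arbitrary admissible C.\<close>

definition umd_bound ::
    "'w itself \<Rightarrow> 'v::{real_normed_vector, second_countable_topology} set \<Rightarrow> ('v \<Rightarrow> real)
      \<Rightarrow> real \<Rightarrow> real \<Rightarrow> bool" where
  "umd_bound _ V N s C \<longleftrightarrow>
     (\<forall>(M :: 'w measure) F n df. filtered_prob_space M F \<and> mart_diff_seq V N s M F n df \<longrightarrow>
        (SUP \<epsilon>\<in>UNIV \<rightarrow> {-1, 1}. Lnorm M (ennreal s) (\<lambda>w. N (\<Sum>k\<le>n. \<epsilon> k *\<^sub>R df k w)))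
          \<le> ennreal C * Lnorm M (ennreal s) (\<lambda>w. N (\<Sum>k\<le>n. df k w)))"

definition S_bound ::
    "'w itself \<Rightarrow> ('k::{real_normed_field, second_countable_topology} \<Rightarrow> 'v::real_normed_vector \<Rightarrow> 'v)
      \<Rightarrow> ('v \<Rightarrow> real) \<Rightarrow> 'i set \<Rightarrow> ('i \<Rightarrow> 'v) \<Rightarrow> real \<Rightarrow> bool" where
  "S_bound _ act N I x C \<longleftrightarrow>
     (\<forall>(M :: 'w measure) A n i \<theta> g.
        filtered_prob_space M A \<and> inj_on i {..n} \<and> i ` {..n} \<subseteq> I \<and>
        (\<forall>k\<le>n. \<theta> k \<in> borel_measurable M \<and> Lnorm M \<infinity> (\<lambda>w. norm (\<theta> k w)) < \<infinity> \<and>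
                is_cond_exp M (A k) (\<theta> k) (g k)) \<longrightarrow>
        Lnorm M 1 (\<lambda>w. N (\<Sum>k\<le>n. act (g k w) (x (i k))))
          \<le> ennreal C * Lnorm M \<infinity> (\<lambda>w. N (\<Sum>k\<le>n. act (\<theta> k w) (x (i k)))))"

lemma umd_const_eq: "umd_const W V N s = Inf {ennreal C | C. 0 \<le> C \<and> umd_bound W V N s C}"
  unfolding umd_const_def umd_bound_def ..

lemma S_const_eq: "S_const W act N I x = Inf {ennreal C | C. 0 \<le> C \<and> S_bound W act N I x C}"
  unfolding S_const_def S_bound_def ..

lemma umd_boundD:
  fixes W :: "'w itself" and M :: "'w measure"
  assumes "umd_bound W V N s C" "filtered_prob_space M F" "mart_diff_seq V N s M F n df"
  shows "(SUP \<epsilon>\<in>UNIV \<rightarrow> {-1, 1}. Lnorm M (ennreal s) (\<lambda>w. N (\<Sum>k\<le>n. \<epsilon> k *\<^sub>R df k w)))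
          \<le> ennreal C * Lnorm M (ennreal s) (\<lambda>w. N (\<Sum>k\<le>n. df k w))"
  using assms unfolding umd_bound_def by simp

lemma S_boundD:
  fixes W :: "'w itself" and M :: "'w measure"
  assumes "S_bound W act N I x C" "filtered_prob_space M A" "inj_on i {..n}" "i ` {..n} \<subseteq> I"
    and "\<And>k. k \<le> n \<Longrightarrow> \<theta> k \<in> borel_measurable M \<and>
      Lnorm M \<infinity> (\<lambda>w. norm (\<theta> k w)) < \<infinity> \<and> is_cond_exp M (A k) (\<theta> k) (g k)"
  shows "Lnorm M 1 (\<lambda>w. N (\<Sum>k\<le>n. act (g k w) (x (i k))))
          \<le> ennreal C * Lnorm M \<infinity> (\<lambda>w. N (\<Sum>k\<le>n. act (\<theta> k w) (x (i k))))"
  by (rule assms(1)[unfolded S_bound_def, THEN spec[of _ M], THEN spec[of _ A], THEN spec[of _ n],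
        THEN spec[of _ i], THEN spec[of _ \<theta>], THEN spec[of _ g], THEN mp])
     (use assms(2-5) in simp)

text \<open>The form in which the UMD bound is applied: any sample space that injects into
  \<open>'w\<close>, scalar coordinates in place of vectors, and one sign pattern, which is bounded
  by the supremum over all of them.\<close>

lemma umd_bound_coordinates:
  fixes W :: "'w itself" and h :: "'u \<Rightarrow> 'w" and d :: "nat \<Rightarrow> (bool \<times> bool) list \<Rightarrow> 'u \<Rightarrow> 'k::{real_normed_field, euclidean_space}"
  assumes C: "umd_bound W (E_space N :: ((bool \<times> bool) list \<Rightarrow>\<^sub>0 'k) set) (E_norm p q N) s C"
    and inj: "inj_on h (space M)" and F: "filtered_prob_space M F"
    and meas: "\<And>m w. m \<le> n \<Longrightarrow> w \<in> E_index N \<Longrightarrow> d m w \<in> borel_measurable (F m)"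
    and fin: "\<And>m. m \<le> n \<Longrightarrow> Lnorm M (ennreal s) (\<lambda>x. E_norm_fun p q N (\<lambda>w. d m w x)) < \<infinity>"
    and ce: "\<And>m w. m < n \<Longrightarrow> w \<in> E_index N \<Longrightarrow> is_cond_exp M (F m) (d (Suc m) w) (\<lambda>_. 0)"
    and \<epsilon>: "\<epsilon> \<in> UNIV \<rightarrow> {-1, 1}"
  shows "Lnorm M (ennreal s) (\<lambda>x. E_norm_fun p q N (\<lambda>w. \<Sum>m\<le>n. \<epsilon> m *\<^sub>R d m w x))
      \<le> ennreal C * Lnorm M (ennreal s) (\<lambda>x. E_norm_fun p q N (\<lambda>w. \<Sum>m\<le>n. d m w x))"
proof -
  define h' where "h' = the_inv_into (space M) h"
  define M' where "M' = embed_measure M h"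
  define df where "df m z = (\<Sum>w\<in>E_index N. Poly_Mapping.single w (d m w (h' z)))" for m z
  have sub: "subalgebra M (F k)" for k using F by (simp add: filtered_prob_space_def)
  have sp: "space (F k) = space M" for k using sub[of k] by (simp add: subalgebra_def)
  have measM: "d m w \<in> borel_measurable M" if "m \<le> n" "w \<in> E_index N" for m w
    using meas[OF that] sub[of m] by (rule measurable_from_subalg[rotated])
  have lookup: "Poly_Mapping.lookup (df m z) w = d m w (h' z)" if "length w = N" for m w z
    using that by (simp add: df_def lookup_sum_single finite_E_index) (simp add: E_index_def)
  have norm_df: "E_norm p q N (df m z) = E_norm_fun p q N (\<lambda>w. d m w (h' z))" for m z
    unfolding E_norm_def by (rule E_norm_fun_cong_norm) (simp add: lookup)
  have norm_sum: "E_norm p q N (\<Sum>m\<le>n. c m *\<^sub>R df m z) = E_norm_fun p q N (\<lambda>w. \<Sum>m\<le>n. c m *\<^sub>R d m w (h' z))"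
    for c :: "nat \<Rightarrow> real" and z
    unfolding E_norm_def
    by (rule E_norm_fun_cong_norm) (simp add: lookup lookup_sum lookup_scaleR)
  have Ln: "Lnorm M' s' (\<lambda>z. E_norm_fun p q N (\<lambda>w. b w (h' z))) = Lnorm M s' (\<lambda>x. E_norm_fun p q N (\<lambda>w. b w x))"
    if "\<And>w. w \<in> E_index N \<Longrightarrow> b w \<in> borel_measurable M" for b :: "_ \<Rightarrow> 'u \<Rightarrow> 'k" and s'
    unfolding M'_def h'_def
    using that by (intro Lnorm_embed_measure[OF inj] borel_measurable_E_norm_fun) (simp add: E_index_def)
  have md: "mart_diff_seq (E_space N) (E_norm p q N) s M' (\<lambda>k. embed_measure (F k) h) n df"
    unfolding mart_diff_seq_def
  proof (intro conjI allI impI ballI)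
    fix k assume k: "k \<le> n"
    have "(\<lambda>z. d k w (h' z)) \<in> borel_measurable (embed_measure (F k) h)" if "w \<in> E_index N" for w
      using measurable_comp_the_inv_into[of h "F k" "d k w" borel] inj meas[OF k that]
      by (simp add: sp h'_def)
    then show "df k \<in> borel_measurable (embed_measure (F k) h)"
      unfolding df_def by (rule borel_measurable_sum_single)
    show "df k z \<in> E_space N" for z
      unfolding E_space_def df_def
      by (auto simp: in_keys_iff lookup_sum_single finite_E_index split: if_splits)
    show "Lnorm M' (ennreal s) (\<lambda>z. E_norm p q N (df k z)) < \<infinity>"
      unfolding norm_df using Ln[of "d k"] measM[OF k] fin[OF k] by simp
  next
    fix k assume k: "k < n"
    have "subalgebra M' (embed_measure (F k) h)"
      using filtered_prob_space_embed_measure[OF F inj] by (simp add: filtered_prob_space_def M'_def)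
    moreover have "is_cond_exp M' (embed_measure (F k) h) (\<lambda>z. d (Suc k) w (h' z)) (\<lambda>_. 0)"
      if "w \<in> E_index N" for w
      unfolding M'_def h'_def using is_cond_exp_embed_measure[OF inj sub ce[OF k that]] .
    ultimately show "is_cond_exp M' (embed_measure (F k) h) (df (Suc k)) (\<lambda>_. 0)"
      unfolding df_def by (intro is_cond_exp_sum_single)
  qed
  have "Lnorm M' (ennreal s) (\<lambda>z. E_norm p q N (\<Sum>k\<le>n. \<epsilon> k *\<^sub>R df k z))
      \<le> (SUP \<epsilon>\<in>UNIV \<rightarrow> {-1, 1}. Lnorm M' (ennreal s) (\<lambda>z. E_norm p q N (\<Sum>k\<le>n. \<epsilon> k *\<^sub>R df k z)))"
    using \<epsilon> by (rule SUP_upper)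
  also have "\<dots> \<le> ennreal C * Lnorm M' (ennreal s) (\<lambda>z. E_norm p q N (\<Sum>k\<le>n. df k z))"
    by (rule umd_boundD[OF C _ md]) (unfold M'_def, rule filtered_prob_space_embed_measure[OF F inj])
  finally show ?thesis
    using norm_sum[of \<epsilon>] norm_sum[of "\<lambda>_. 1"] measM
      Ln[of "\<lambda>w x. \<Sum>m\<le>n. \<epsilon> m *\<^sub>R d m w x"] Ln[of "\<lambda>w x. \<Sum>m\<le>n. d m w x"]
    by simp
qed

text \<open>Since \<open>i\<close> lists every word exactly once, the sum over k is the full vector,
  and the order of the list decides which sigma-algebra conditions which coordinate.\<close>

lemma S_bound_coordinates:
  fixes W :: "'w itself" and h :: "'u \<Rightarrow> 'w" and \<theta> g :: "(bool \<times> bool) list \<Rightarrow> 'u \<Rightarrow> 'k::{real_normed_field, euclidean_space}"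
  assumes C: "S_bound W (E_scale :: 'k \<Rightarrow> _) (E_norm p q N) (E_index N) E_basis C"
    and inj: "inj_on h (space M)" and A: "filtered_prob_space M A"
    and i: "bij_betw i {..n} (E_index N)"
    and meas: "\<And>w. w \<in> E_index N \<Longrightarrow> \<theta> w \<in> borel_measurable M"
    and fin: "\<And>w. w \<in> E_index N \<Longrightarrow> Lnorm M \<infinity> (\<lambda>x. norm (\<theta> w x)) < \<infinity>"
    and ce: "\<And>k. k \<le> n \<Longrightarrow> is_cond_exp M (A k) (\<theta> (i k)) (g (i k))"
  shows "Lnorm M 1 (\<lambda>x. E_norm_fun p q N (\<lambda>w. g w x))
      \<le> ennreal C * Lnorm M \<infinity> (\<lambda>x. E_norm_fun p q N (\<lambda>w. \<theta> w x))"
proof -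
  define h' where "h' = the_inv_into (space M) h"
  define M' where "M' = embed_measure M h"
  have sub: "subalgebra M (A k)" for k using A by (simp add: filtered_prob_space_def)
  have norm_sum: "E_norm p q N (\<Sum>k\<le>n. E_scale (b (i k)) (E_basis (i k))) = E_norm_fun p q N b"
    for b :: "_ \<Rightarrow> 'k"
  proof -
    have eq: "(\<Sum>k\<le>n. E_scale (b (i k)) (E_basis (i k))) = (\<Sum>w\<in>E_index N. Poly_Mapping.single w (b w))"
      unfolding E_scale_basis by (rule sum.reindex_bij_betw[OF i])
    show ?thesis
      unfolding eq E_norm_def
      by (rule E_norm_fun_cong_norm) (simp add: lookup_sum_single finite_E_index, simp add: E_index_def)
  qed
  have Ln: "Lnorm M' s' (\<lambda>z. E_norm_fun p q N (\<lambda>w. b w (h' z))) = Lnorm M s' (\<lambda>x. E_norm_fun p q N (\<lambda>w. b w x))"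
    if "\<And>w. w \<in> E_index N \<Longrightarrow> b w \<in> borel_measurable M" for b :: "_ \<Rightarrow> 'u \<Rightarrow> 'k" and s'
    unfolding M'_def h'_def
    using that by (intro Lnorm_embed_measure[OF inj] borel_measurable_E_norm_fun) (simp add: E_index_def)
  have measg: "g w \<in> borel_measurable M" if w: "w \<in> E_index N" for w
  proof -
    obtain k where "k \<le> n" "w = i k" using w bij_betw_imp_surj_on[OF i] by auto
    then show ?thesis using ce[of k] by (auto simp: is_cond_exp_def)
  qed
  have hyp: "(\<lambda>z. \<theta> (i k) (h' z)) \<in> borel_measurable M' \<and>
      Lnorm M' \<infinity> (\<lambda>z. norm (\<theta> (i k) (h' z))) < \<infinity> \<and>
      is_cond_exp M' (embed_measure (A k) h) (\<lambda>z. \<theta> (i k) (h' z)) (\<lambda>z. g (i k) (h' z))"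
    if k: "k \<le> n" for k
  proof -
    have ik: "i k \<in> E_index N" using k i by (auto simp: bij_betw_def)
    note [measurable] = meas[OF ik]
    have "Lnorm M' \<infinity> (\<lambda>z. norm (\<theta> (i k) (h' z))) = Lnorm M \<infinity> (\<lambda>x. norm (\<theta> (i k) x))"
      unfolding M'_def h'_def by (rule Lnorm_embed_measure[OF inj]) simp
    then show ?thesis
      using fin[OF ik] measurable_comp_the_inv_into[OF inj meas[OF ik]]
        is_cond_exp_embed_measure[OF inj sub ce[OF k]]
      by (simp add: M'_def h'_def)
  qed
  have "filtered_prob_space M' (\<lambda>k. embed_measure (A k) h)"
    unfolding M'_def using filtered_prob_space_embed_measure[OF A inj] .
  moreover have "inj_on i {..n}" "i ` {..n} \<subseteq> E_index N" using i by (auto simp: bij_betw_def)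
  ultimately have "Lnorm M' 1 (\<lambda>z. E_norm p q N (\<Sum>k\<le>n. E_scale (g (i k) (h' z)) (E_basis (i k))))
      \<le> ennreal C * Lnorm M' \<infinity> (\<lambda>z. E_norm p q N (\<Sum>k\<le>n. E_scale (\<theta> (i k) (h' z)) (E_basis (i k))))"
    by (intro S_boundD[OF C]) (use hyp in auto)
  then show ?thesis
    using norm_sum[of "\<lambda>w. g w (h' _)"] norm_sum[of "\<lambda>w. \<theta> w (h' _)"] Ln[of g] Ln[of \<theta>] measg meas
    by simp
qed

section \<open>The lower bound by powers of $c(p, q)$\<close>

definition bool_mean :: "(bool \<Rightarrow> 'k::real_normed_field) \<Rightarrow> 'k" where
  "bool_mean f = (f False + f True) / 2"

text \<open>Up to the factor 2^(1/p), which cancels in the definition of c(p,q), this is the norm of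
  (f, g) in L_p(\<mu>; l_q). It is also the \<open>E_1\<close> norm of the four values.\<close>

definition pair_norm ::
    "ennreal \<Rightarrow> ennreal \<Rightarrow> (bool \<Rightarrow> 'k::real_normed_field) \<Rightarrow> (bool \<Rightarrow> 'k) \<Rightarrow> real" where
  "pair_norm p q f g =
     ell2 p (ell2 q (norm (f False)) (norm (g False))) (ell2 q (norm (f True)) (norm (g True)))"

lemma pair_norm_nonneg: "0 \<le> pair_norm p q f g"
  unfolding pair_norm_def by (intro ell2_nonneg) simp_all

text \<open>The formula includes p = \<infinity>: there \<open>enn2real p\<close> is 0, the quotient
  is 0 by convention, and the factor in front is 1.\<close>

lemma Lnorm_rademacher:
  assumes p: "1 \<le> p" and h: "\<And>t. 0 \<le> h t"
  shows "Lnorm rademacher p h = ennreal (2 powr (- 1 / enn2real p) * ell2 p (h (-1)) (h 1))"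
proof (cases "p = \<infinity>")
  case True
  have meas: "(\<lambda>w. ennreal \<bar>h w\<bar>) \<in> borel_measurable rademacher"
    by (simp add: uniform_count_measure_def)
  have AE: "(AE x in rademacher. P x) \<longleftrightarrow> P (-1) \<and> P 1" for P
    unfolding uniform_count_measure_def by (subst AE_point_measure) (simp add: zero_less_iff_neq_zero)
  have "esssup rademacher (\<lambda>w. ennreal \<bar>h w\<bar>) = ennreal (max (h (-1)) (h 1))"
  proof (rule antisym)
    show "esssup rademacher (\<lambda>w. ennreal \<bar>h w\<bar>) \<le> ennreal (max (h (-1)) (h 1))"
      by (rule esssup_I[OF meas]) (simp add: AE h ennreal_leI)
    show "ennreal (max (h (-1)) (h 1)) \<le> esssup rademacher (\<lambda>w. ennreal \<bar>h w\<bar>)"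
      using esssup_AE[of "\<lambda>w. ennreal \<bar>h w\<bar>" rademacher] by (simp add: AE h max_def)
  qed
  then show ?thesis using True by (simp add: Lnorm_def ell2_def)
next
  case False
  define r where "r = enn2real p"
  have r: "1 \<le> r" using enn2real_ge_1[OF p False] by (simp add: r_def)
  have half: "inverse 2 = ennreal (1 / 2)" using inverse_ennreal[of 2] by simp
  have "(\<integral>\<^sup>+ w. ennreal (\<bar>h w\<bar> powr r) \<partial>rademacher)
      = inverse 2 * ennreal (h (-1) powr r) + inverse 2 * ennreal (h 1 powr r)"
    using h unfolding uniform_count_measure_def
    by (subst nn_integral_point_measure_finite) simp_all
  also have "\<dots> = ennreal (1 / 2 * h (-1) powr r + 1 / 2 * h 1 powr r)"
    unfolding half by (subst ennreal_plus) (simp_all only: ennreal_mult' powr_ge_zero, simp_all)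
  finally have "(\<integral>\<^sup>+ w. ennreal (\<bar>h w\<bar> powr r) \<partial>rademacher) = ennreal ((h (-1) powr r + h 1 powr r) / 2)"
    by (simp add: add_divide_distrib)
  then have "Lnorm rademacher p h = ennreal (((h (-1) powr r + h 1 powr r) / 2) powr (1 / r))"
    using False by (simp add: Lnorm_def r_def Let_def)
  also have "((h (-1) powr r + h 1 powr r) / 2) powr (1 / r) = 2 powr (- 1 / r) * ell2 p (h (-1)) (h 1)"
    using False by (simp add: ell2_def r_def powr_divide powr_minus_divide)
  finally show ?thesis by (simp add: r_def)
qed

lemma c_const_eq:
  fixes K :: "'k::{real_normed_field, euclidean_space} itself"
  assumes p: "1 \<le> p"
  shows "c_const K p q = Inf {ennreal C | C. 0 \<le> C \<and>
    (\<forall>f g :: bool \<Rightarrow> 'k. pair_norm p q (\<lambda>_. bool_mean f) g \<le> C * pair_norm p q f g)}"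
proof -
  have L: "Lnorm rademacher p (\<lambda>t. ell2 q (norm (f t)) (norm (g t)))
      = ennreal (2 powr (- 1 / enn2real p) *
          pair_norm p q (\<lambda>b. f (if b then 1 else -1)) (\<lambda>b. g (if b then 1 else -1)))"
    for f g :: "real \<Rightarrow> 'k"
    by (subst Lnorm_rademacher[OF p]) (simp_all add: ell2_nonneg pair_norm_def)
  have mean: "(LINT u|rademacher. f u) = bool_mean (\<lambda>b. f (if b then 1 else -1))" for f :: "real \<Rightarrow> 'k"
    unfolding uniform_count_measure_def
    by (subst lebesgue_integral_point_measure_finite)
       (simp_all add: bool_mean_def add_divide_distrib scaleR_conv_of_real)
  have *: "(Lnorm rademacher p (\<lambda>t. ell2 q (norm (LINT u|rademacher. f u)) (norm (g t)))
          \<le> ennreal C * Lnorm rademacher p (\<lambda>t. ell2 q (norm (f t)) (norm (g t)))) \<longleftrightarrow>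
      pair_norm p q (\<lambda>_. bool_mean (\<lambda>b. f (if b then 1 else -1))) (\<lambda>b. g (if b then 1 else -1))
        \<le> C * pair_norm p q (\<lambda>b. f (if b then 1 else -1)) (\<lambda>b. g (if b then 1 else -1))"
    if "0 \<le> C" for C and f g :: "real \<Rightarrow> 'k"
    unfolding L mean using that by (simp add: pair_norm_nonneg mult.left_commute[of C] flip: ennreal_mult')
  have "(\<forall>(f :: real \<Rightarrow> 'k) (g :: real \<Rightarrow> 'k). P (\<lambda>b. f (if b then 1 else -1)) (\<lambda>b. g (if b then 1 else -1)))
      \<longleftrightarrow> (\<forall>f g. P f g)" for P :: "(bool \<Rightarrow> 'k) \<Rightarrow> (bool \<Rightarrow> 'k) \<Rightarrow> bool"
  proof (intro iffI allI)
    fix f g :: "bool \<Rightarrow> 'k"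
    assume P: "\<forall>(f :: real \<Rightarrow> 'k) (g :: real \<Rightarrow> 'k). P (\<lambda>b. f (if b then 1 else -1)) (\<lambda>b. g (if b then 1 else -1))"
    \<comment> \<open>Any two values are attained at -1 and 1 by some function on the reals, so
      quantifying over functions on the reals and over functions on \<open>bool\<close> is the
      same.\<close>
    have "\<exists>h'. h = (\<lambda>b. h' (if b then 1 else -1 :: real))" for h :: "bool \<Rightarrow> 'k"
      by (rule exI[of _ "\<lambda>t. h (t = 1)"]) auto
    then obtain f' g' where "f = (\<lambda>b. f' (if b then 1 else -1 :: real))" "g = (\<lambda>b. g' (if b then 1 else -1 :: real))"
      by metis
    then show "P f g" using P by simp
  qed simp
  from this[of "\<lambda>f g. pair_norm p q (\<lambda>_. bool_mean f) g \<le> _ * pair_norm p q f g"]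
  show ?thesis unfolding c_const_def using * by (intro arg_cong[where f = Inf]) auto
qed

text \<open>A sample for words of length \<open>n + 1\<close> is a sample for the tails of the words at an \<open>f\<close> coordinate,
  followed by the flip and by a sample for the tails at a \<open>g\<close> coordinate. The coefficient of \<open>w\<close>
  is conditioned on the first \<open>game_time w\<close> coins.\<close>

primrec game_depth :: "nat \<Rightarrow> nat" where
  "game_depth 0 = 0"
| "game_depth (Suc n) = Suc (2 * game_depth n)"

primrec game_time :: "(bool \<times> bool) list \<Rightarrow> nat" where
  "game_time [] = 0"
| "game_time (x # w) = (if snd x then Suc (game_depth (length w)) + game_time w else game_time w)"

primrec game :: "(bool \<Rightarrow> 'k::real_normed_field) \<Rightarrow> (bool \<Rightarrow> 'k) \<Rightarrow> (bool \<times> bool) list \<Rightarrow> bool list \<Rightarrow> 'k" where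
  "game f g [] l = 1"
| "game f g (x # w) l =
     (let m = game_depth (length w) in
      if snd x then g (fst x \<noteq> l ! m) * game f g w (drop (Suc m) l)
      else f (fst x \<noteq> l ! m) * game f g w (take m l))"

text \<open>A word starting with an f letter is conditioned at a time no later than the flip, which
  is therefore averaged out. A g letter is conditioned after the flip and keeps it.\<close>

primrec game_exp :: "(bool \<Rightarrow> 'k::real_normed_field) \<Rightarrow> (bool \<Rightarrow> 'k) \<Rightarrow> (bool \<times> bool) list \<Rightarrow> bool list \<Rightarrow> 'k" where
  "game_exp f g [] l = 1"
| "game_exp f g (x # w) l =
     (let m = game_depth (length w) in
      if snd x then g (fst x \<noteq> l ! m) * game_exp f g w (drop (Suc m) l)
      else bool_mean f * game_exp f g w (take m l))"

lemma game_time_le: "game_time w \<le> game_depth (length w)"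
  by (induction w) auto

text \<open>Supplies the measurability of the conditional expectation: it depends on the revealed
  coins only.\<close>

lemma game_exp_take: "game_exp f g w (take (game_time w) l) = game_exp f g w l"
proof (induction w arbitrary: l)
  case (Cons x w)
  let ?m = "game_depth (length w)"
  show ?case
  proof (cases "snd x")
    case True
    then show ?thesis using Cons[of "drop (Suc ?m) l"] by (simp add: Let_def drop_take)
  next
    case False
    have "take ?m (take (game_time w) l) = take (game_time w) (take ?m l)"
      by (simp add: min.commute)
    then show ?thesis using False Cons[of "take ?m l"] by (simp add: Let_def)
  qed
qed simp

lemma pair_norm_flip:
  "ell2 p (ell2 q (norm (f (False \<noteq> e))) (norm (g (False \<noteq> e))))
          (ell2 q (norm (f (True \<noteq> e))) (norm (g (True \<noteq> e)))) = pair_norm p q f g"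
  by (cases e) (simp_all add: pair_norm_def ell2_commute)

text \<open>The tails below f and g use different coins, but by induction their norms are the same
  constant for every sample. This constant factors out of both l_q norms and the l_p norm, leaving
  one flipped pair, whose norm is independent of the flip.\<close>

lemma E_norm_fun_game:
  assumes p: "1 \<le> p" and q: "1 \<le> q"
  shows "E_norm_fun p q n (\<lambda>w. game f g w l) = pair_norm p q f g ^ n"
    and "E_norm_fun p q n (\<lambda>w. game_exp f g w l) = pair_norm p q (\<lambda>_. bool_mean f) g ^ n"
proof (induction n arbitrary: l)
  case (Suc n)
  let ?m = "game_depth n"
  have letter: "E_norm_fun p q n (\<lambda>w. game f g ((a, b) # w) l)
      = norm ((if b then g else f) (a \<noteq> l ! ?m)) * pair_norm p q f g ^ n" for a b l
  proof -
    have "E_norm_fun p q n (\<lambda>w. game f g ((a, b) # w) l)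
        = E_norm_fun p q n (\<lambda>w. (if b then g else f) (a \<noteq> l ! ?m) *
            game f g w (if b then drop (Suc ?m) l else take ?m l))"
      by (rule E_norm_fun_cong_norm) (simp add: Let_def)
    then show ?thesis by (simp only: E_norm_fun_scale[OF p q] Suc(1))
  qed
  have letter_exp: "E_norm_fun p q n (\<lambda>w. game_exp f g ((a, b) # w) l)
      = norm ((if b then g else (\<lambda>_. bool_mean f)) (a \<noteq> l ! ?m)) * pair_norm p q (\<lambda>_. bool_mean f) g ^ n" for a b l
  proof -
    have "E_norm_fun p q n (\<lambda>w. game_exp f g ((a, b) # w) l)
        = E_norm_fun p q n (\<lambda>w. (if b then g else (\<lambda>_. bool_mean f)) (a \<noteq> l ! ?m) *
            game_exp f g w (if b then drop (Suc ?m) l else take ?m l))"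
      by (rule E_norm_fun_cong_norm) (simp add: Let_def)
    then show ?thesis by (simp only: E_norm_fun_scale[OF p q] Suc(2))
  qed
  have pull: "ell2 p (ell2 q (a * c) (b * c)) (ell2 q (a' * c) (b' * c)) = ell2 p (ell2 q a b) (ell2 q a' b') * c"
    if "0 \<le> a" "0 \<le> b" "0 \<le> a'" "0 \<le> b'" "0 \<le> c" for a b a' b' c
    using that ell2_scale[OF q, of c a b] ell2_scale[OF q, of c a' b']
      ell2_scale[OF p, of c "ell2 q a b" "ell2 q a' b'"]
    by (simp add: mult.commute ell2_nonneg)
  case 1
  show ?case
    unfolding E_norm_fun.simps letter
    by (subst pull) (simp_all add: pair_norm_nonneg pair_norm_flip[of p q f "l ! ?m" g, simplified])
  case 2
  show ?case
    unfolding E_norm_fun.simps letter_exp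
    by (subst pull) (simp_all add: pair_norm_nonneg pair_norm_flip[of p q "\<lambda>_. bool_mean f" "l ! ?m" g, simplified])
qed simp_all

lemma sum_lists_split:
  "(\<Sum>l | length l = j + Suc k. F l) = (\<Sum>u | length u = j. \<Sum>e\<in>UNIV. \<Sum>v | length v = k. F (u @ e # v))"
  for F :: "bool list \<Rightarrow> 'a::comm_monoid_add"
proof -
  have "(\<Sum>l | length l = j + Suc k. F l)
      = (\<Sum>(u, e, v)\<in>{u. length u = j} \<times> UNIV \<times> {v. length v = k}. F (u @ e # v))"
    by (rule sum.reindex_bij_witness[of _ "\<lambda>(u, e, v). u @ e # v" "\<lambda>l. (take j l, l ! j, drop (Suc j) l)"])
       (auto simp: id_take_nth_drop[symmetric])
  then show ?thesis by (simp only: sum.cartesian_product)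
qed

text \<open>The averaging property of conditional expectation, tested against every function c of
  the revealed coins. The arbitrary c makes the induction work: for a g letter the first block and
  the flip are frozen and absorbed into c.\<close>

lemma sum_game:
  fixes c :: "bool list \<Rightarrow> 'k::real_normed_field"
  shows "(\<Sum>l | length l = game_depth (length w). c (take (game_time w) l) * game f g w l)
       = (\<Sum>l | length l = game_depth (length w). c (take (game_time w) l) * game_exp f g w l)"
proof (induction w arbitrary: c)
  case (Cons x w)
  let ?m = "game_depth (length w)"
  have m: "game_depth (length (x # w)) = ?m + Suc ?m" by simp
  show ?case
  proof (cases "snd x")
    case True
    show ?thesis
      unfolding m sum_lists_split
    proof (rule sum.cong[OF refl], rule sum.cong[OF refl], goal_cases)
      case (1 u e)
      then show ?case
        using True Cons[of "\<lambda>v. c (u @ e # v) * g (fst x \<noteq> e)"]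
        by (simp add: Let_def nth_append mult.assoc)
    qed
  next
    case False
    \<comment> \<open>For an f letter, c sees only coins of the first block u. The last block then
      contributes its cardinality 2^m, and the sum over the flip is twice the mean of f.\<close>
    have t: "take (game_time w) (u @ v) = take (game_time w) u" if "length u = ?m" for u v :: "bool list"
      using that game_time_le[of w] by simp
    have tm: "take ?m (u @ v) = u" if "length u = ?m" for u v :: "bool list"
      using that by simp
    have card: "card {v :: bool list. length v = ?m} = 2 ^ ?m"
      using card_lists_length_eq[of "UNIV :: bool set" ?m] by simp
    have f: "(\<Sum>e\<in>UNIV. f (fst x \<noteq> e)) = 2 * bool_mean f"
      by (cases "fst x") (simp_all add: UNIV_bool bool_mean_def)
    have "(\<Sum>u | length u = ?m. \<Sum>e\<in>UNIV. \<Sum>v | length v = ?m.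
            c (take (game_time (x # w)) (u @ e # v)) * game f g (x # w) (u @ e # v))
        = (\<Sum>u | length u = ?m. \<Sum>e\<in>UNIV. 2 ^ ?m * (f (fst x \<noteq> e) * (c (take (game_time w) u) * game f g w u)))"
      using False by (intro sum.cong refl) (simp add: Let_def t tm nth_append card ac_simps del: take_append)
    also have "\<dots> = 2 ^ ?m * (2 * bool_mean f) * (\<Sum>u | length u = ?m. c (take (game_time w) u) * game f g w u)"
      by (simp only: f[symmetric] sum_distrib_left[symmetric] sum_distrib_right[symmetric] mult.assoc)
    also have "\<dots> = (\<Sum>u | length u = ?m. \<Sum>e\<in>(UNIV :: bool set). \<Sum>v\<in>{v :: bool list. length v = ?m}.
            c (take (game_time (x # w)) (u @ e # v)) * game_exp f g (x # w) (u @ e # v))"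
      unfolding Cons
      using False by (simp add: Let_def t tm card sum_distrib_left ac_simps del: take_append)
    finally show ?thesis unfolding m sum_lists_split .
  qed
qed simp

section \<open>Coin filtrations and the test of S on the game\<close>

definition list_filtration :: "nat \<Rightarrow> nat \<Rightarrow> bool list measure" where
  "list_filtration m t = vimage_algebra {l. length l = m} (take t) (count_space UNIV)"

lemma finite_bool_lists: "finite {l :: bool list. length l = m}"
  using finite_lists_length_eq[of "UNIV :: bool set" m] by simp

lemma sets_list_filtration:
  "sets (list_filtration m t) = {take t -` B \<inter> {l. length l = m} | B. True}"
  by (simp add: list_filtration_def sets_vimage_algebra2)

lemma space_list_filtration: "space (list_filtration m t) = {l. length l = m}"
  by (simp add: list_filtration_def)

lemma filtered_prob_space_list_filtration:
  assumes T: "mono T"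
  shows "filtered_prob_space (uniform_count_measure {l :: bool list. length l = m}) (\<lambda>k. list_filtration m (T k))"
proof -
  let ?L = "{l :: bool list. length l = m}"
  have "replicate m True \<in> ?L" by simp
  then have ne: "?L \<noteq> {}" by blast
  have "sets (list_filtration m (T i)) \<subseteq> sets (list_filtration m (T j))" if "i \<le> j" for i j
  proof
    fix A assume "A \<in> sets (list_filtration m (T i))"
    then obtain B where "A = take (T i) -` B \<inter> ?L" by (auto simp: sets_list_filtration)
    then have "A = take (T j) -` (take (T i) -` B) \<inter> ?L"
      using monoD[OF T that] by (auto simp: min_absorb1)
    then show "A \<in> sets (list_filtration m (T j))" by (auto simp: sets_list_filtration)
  qed
  moreover have "subalgebra (uniform_count_measure ?L) (list_filtration m t)" for t
    by (auto simp: subalgebra_def sets_list_filtration space_list_filtration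
        space_uniform_count_measure sets_uniform_count_measure)
  ultimately show ?thesis
    using prob_space_uniform_count_measure[OF finite_bool_lists ne]
    by (simp add: filtered_prob_space_def filtration_def space_list_filtration space_uniform_count_measure)
qed

lemma is_cond_exp_game:
  fixes f g :: "bool \<Rightarrow> 'k::{real_normed_field, euclidean_space}"
  assumes m: "m = game_depth (length w)"
  shows "is_cond_exp (uniform_count_measure {l. length l = m}) (list_filtration m (game_time w))
           (game f g w) (game_exp f g w)"
proof -
  let ?L = "{l :: bool list. length l = m}"
  let ?M = "uniform_count_measure ?L"
  have int: "integrable ?M u" for u :: "bool list \<Rightarrow> 'k"
    unfolding uniform_count_measure_def by (intro integrable_point_measure_finite finite_bool_lists)
  have integral: "set_lebesgue_integral ?M A u = (\<Sum>l\<in>?L. (1 / card ?L) *\<^sub>R (indicator A l *\<^sub>R u l))"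
    for A and u :: "bool list \<Rightarrow> 'k"
    unfolding set_lebesgue_integral_def uniform_count_measure_def
    by (subst lebesgue_integral_point_measure_finite[OF finite_bool_lists]) simp_all
  have "take (game_time w) \<in> measurable (list_filtration m (game_time w)) (count_space UNIV)"
    unfolding list_filtration_def by (rule measurable_vimage_algebra1) simp
  then have "(\<lambda>l. game_exp f g w (take (game_time w) l)) \<in> borel_measurable (list_filtration m (game_time w))"
    by (rule measurable_compose) simp
  moreover have "set_lebesgue_integral ?M A (game f g w) = set_lebesgue_integral ?M A (game_exp f g w)"
    if "A \<in> sets (list_filtration m (game_time w))" for A
  proof -
    obtain B where B: "A = take (game_time w) -` B \<inter> ?L" using \<open>A \<in> _\<close> by (auto simp: sets_list_filtration)
    \<comment> \<open>Membership in \<open>A\<close> depends on the revealed coins only, so its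
      indicator is a test function for \<open>sum_game\<close>.\<close>
    have ind: "indicator A l *\<^sub>R u = indicator B (take (game_time w) l) * u" if "l \<in> ?L" for l and u :: 'k
      using that by (simp add: B indicator_def)
    show ?thesis
      unfolding integral scaleR_sum_right[symmetric]
      using sum_game[of "indicator B" w f g] by (simp add: ind m[symmetric])
  qed
  ultimately show ?thesis by (simp add: is_cond_exp_def int game_exp_take)
qed

lemma Lnorm_const:
  assumes "prob_space M" and c: "0 \<le> c"
  shows "Lnorm M 1 (\<lambda>_. c) = ennreal c" and "Lnorm M \<infinity> (\<lambda>_. c) = ennreal c"
proof -
  interpret prob_space M by fact
  show "Lnorm M 1 (\<lambda>_. c) = ennreal c" "Lnorm M \<infinity> (\<lambda>_. c) = ennreal c"
    using c by (simp_all add: Lnorm_def emeasure_space_1 esssup_const)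
qed

lemma S_bound_game:
  fixes W :: "'w itself" and f g :: "bool \<Rightarrow> 'k::{real_normed_field, euclidean_space}"
  assumes p: "1 \<le> p" and q: "1 \<le> q" and inf: "infinite (UNIV :: 'w set)" and C0: "0 \<le> C"
    and C: "S_bound W (E_scale :: 'k \<Rightarrow> _) (E_norm p q n) (E_index n) E_basis C"
  shows "pair_norm p q (\<lambda>_. bool_mean f) g ^ n \<le> C * pair_norm p q f g ^ n"
proof -
  define m where "m = game_depth n"
  let ?M = "uniform_count_measure {l :: bool list. length l = m}"
  obtain h0 :: "nat \<Rightarrow> 'w" where h0: "inj h0"
    using inf infinite_iff_countable_subset[of "UNIV :: 'w set"] by auto
  define h where "h = h0 \<circ> (to_nat :: bool list \<Rightarrow> nat)"
  have h: "inj_on h (space ?M)" unfolding h_def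
    by (rule inj_on_subset[OF _ subset_UNIV]) (intro inj_compose h0 inj_to_nat)
  obtain ys where ys: "set ys = E_index n" "distinct ys"
    using finite_distinct_list[OF finite_E_index] by metis
  \<comment> \<open>The definition of S conditions the k-th term on the k-th sigma-algebra, and
    these must increase with k. Listing the words by \<open>game_time\<close> achieves this.\<close>
  define xs where "xs = sort_key game_time ys"
  have xs: "set xs = E_index n" "distinct xs" "sorted (map game_time xs)"
    using ys by (simp_all add: xs_def)
  define N where "N = length xs - 1"
  have "replicate n (True, True) \<in> set xs" by (simp add: xs E_index_def)
  then have len: "length xs = Suc N" unfolding N_def by (cases xs) auto
  \<comment> \<open>The minimum freezes the filtration after the last word, so that it is monotone
    on all of the natural numbers.\<close>
  define T where "T k = game_time (xs ! min k N)" for k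
  have T: "mono T"
    unfolding T_def by (intro monoI) (use xs(3) len in \<open>auto simp: sorted_iff_nth_mono\<close>)
  have i: "bij_betw ((!) xs) {..N} (E_index n)"
    using bij_betw_nth[OF xs(2) _ xs(1)[symmetric]] len by (simp add: lessThan_Suc_atMost)
  note filt = filtered_prob_space_list_filtration[OF T, of m]
  then have prob: "prob_space ?M" by (simp add: filtered_prob_space_def)
  have meas: "u \<in> borel_measurable ?M" for u :: "bool list \<Rightarrow> 'b::topological_space"
    by (simp add: uniform_count_measure_def)
  have fin: "Lnorm ?M \<infinity> (\<lambda>x. norm (game f g w x)) < \<infinity>" for w
  proof -
    have "esssup ?M (\<lambda>x. ennreal \<bar>norm (game f g w x)\<bar>) \<le> ennreal (\<Sum>l | length l = m. norm (game f g w l))"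
    proof (intro esssup_I meas AE_I2 ennreal_leI)
      fix x assume "x \<in> space ?M"
      then show "\<bar>norm (game f g w x)\<bar> \<le> (\<Sum>l | length l = m. norm (game f g w l))"
        using member_le_sum[of x "{l. length l = m}" "\<lambda>l. norm (game f g w l)"]
        by (simp add: space_uniform_count_measure finite_bool_lists)
    qed
    then show ?thesis by (simp add: Lnorm_def le_less_trans[OF _ ennreal_less_top])
  qed
  have ce: "is_cond_exp ?M (list_filtration m (T k)) (game f g (xs ! k)) (game_exp f g (xs ! k))"
    if "k \<le> N" for k
  proof -
    have "xs ! k \<in> E_index n" using that len by (simp flip: xs(1))
    then show ?thesis
      using is_cond_exp_game[of m "xs ! k" f g] that by (simp add: m_def E_index_def T_def)
  qed
  have "Lnorm ?M 1 (\<lambda>x. E_norm_fun p q n (\<lambda>w. game_exp f g w x))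
      \<le> ennreal C * Lnorm ?M \<infinity> (\<lambda>x. E_norm_fun p q n (\<lambda>w. game f g w x))"
    by (rule S_bound_coordinates[OF C h filt i meas fin ce])
  then show ?thesis
    unfolding E_norm_fun_game[OF p q] Lnorm_const[OF prob zero_le_power[OF pair_norm_nonneg]]
    using C0 by (simp add: pair_norm_nonneg flip: ennreal_mult')
qed

lemma c_const_power_le_E_S:
  fixes K :: "'k::{real_normed_field, euclidean_space} itself" and W :: "'w itself"
  assumes p: "1 \<le> p" and q: "1 \<le> q" and inf: "infinite (UNIV :: 'w set)" and n: "1 \<le> n"
  shows "c_const K p q ^ n \<le> E_S W K p q n"
  unfolding E_S_def S_const_eq
proof (rule Inf_greatest, clarify)
  fix C :: real assume C: "0 \<le> C"
    and S: "S_bound W (E_scale :: 'k \<Rightarrow> _) (E_norm p q n) (E_index n) E_basis C"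
  define D where "D = root n C"
  have D: "0 \<le> D" "D ^ n = C" using C n by (simp_all add: D_def)
  have "pair_norm p q (\<lambda>_. bool_mean f) g \<le> D * pair_norm p q f g" for f g :: "bool \<Rightarrow> 'k"
  proof (rule power_le_imp_le_base)
    show "pair_norm p q (\<lambda>_. bool_mean f) g ^ Suc (n - 1) \<le> (D * pair_norm p q f g) ^ Suc (n - 1)"
      using S_bound_game[OF p q inf C S, of f g] n D by (simp add: power_mult_distrib)
  qed (simp add: D pair_norm_nonneg)
  then have "c_const K p q \<le> ennreal D"
    unfolding c_const_eq[OF p] using D by (intro Inf_lower) auto
  then have "c_const K p q ^ n \<le> ennreal D ^ n" by (intro power_mono) auto
  also have "\<dots> = ennreal C" using D by (simp add: ennreal_power)
  finally show "c_const K p q ^ n \<le> ennreal C" .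
qed

section \<open>Strict inequality $c(p, q) > 1$\<close>

lemma ell2_zero_right: "1 \<le> r \<Longrightarrow> 0 \<le> a \<Longrightarrow> ell2 r a 0 = a"
  using enn2real_ge_1[of r] by (cases "r = \<infinity>") (auto simp: ell2_def powr_powr)

text \<open>For finite exponents the norm of \<open>((1 - t, 0), (1 + t, 1))\<close> has a nonzero derivative in \<open>t\<close> at \<open>0\<close>,
  so that averaging the first components increases the norm for some small \<open>t\<close>.\<close>

lemma ell2_averaging_increases_finite:
  assumes p: "1 \<le> p" "p \<noteq> \<infinity>" and q: "1 \<le> q" "q \<noteq> \<infinity>" and pq: "p \<noteq> q"
  obtains t where "\<bar>t\<bar> \<le> 1" "ell2 p (1 - t) (ell2 q (1 + t) 1) < ell2 p 1 (ell2 q 1 1)"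
proof -
  define r s where "r = enn2real p" and "s = enn2real q"
  have r: "1 \<le> r" and s: "1 \<le> s"
    unfolding r_def s_def using enn2real_ge_1 p q by auto
  have rs: "r \<noteq> s" using pq p q unfolding r_def s_def
    by (metis ennreal_enn2real infinity_ennreal_def less_top)
  define \<phi> where "\<phi> t = (1 - t) powr r + ((1 + t) powr s + 1) powr (r / s)" for t :: real
  \<comment> \<open>This is the derivative of \<phi> at 0, namely -r + r * 2^(r/s - 1); it vanishes
    only if r = s.\<close>
  define l where "l = r * (2 powr (r / s - 1) - 1)"
  have "(\<phi> has_real_derivative
      (r * (1 - 0) powr (r - 1) * (- 1)
        + (r / s) * ((1 + 0) powr s + 1) powr (r / s - 1) * (s * (1 + 0) powr (s - 1)))) (at 0)"
    unfolding \<phi>_def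
    using s by (auto intro!: derivative_eq_intros simp: algebra_simps)
  then have deriv: "DERIV \<phi> 0 :> l"
    using s by (simp add: l_def algebra_simps)
  have "r / s \<noteq> 1" using rs s by simp
  then have "2 powr (r / s - 1) \<noteq> 2 powr 0" by (subst powr_inj) auto
  then have l: "l \<noteq> 0" using r by (simp add: l_def)
  \<comment> \<open>The sign of t is opposite to that of the derivative, and the cap at 1 keeps 1 -
    t and 1 + t nonnegative.\<close>
  obtain t where t: "\<bar>t\<bar> \<le> 1" "\<phi> t < \<phi> 0"
  proof (cases "l > 0")
    case True
    obtain d where d: "d > 0" "\<And>h. 0 < h \<Longrightarrow> h < d \<Longrightarrow> \<phi> (0 - h) < \<phi> 0"
      using DERIV_pos_inc_left[OF deriv True] by auto
    show ?thesis using d(1) d(2)[of "min 1 (d / 2)"] by (intro that[of "- min 1 (d / 2)"]) auto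
  next
    case False
    then have "l < 0" using l by simp
    then obtain d where d: "d > 0" "\<And>h. 0 < h \<Longrightarrow> h < d \<Longrightarrow> \<phi> (0 + h) < \<phi> 0"
      using DERIV_neg_dec_right[OF deriv] by auto
    show ?thesis using d(1) d(2)[of "min 1 (d / 2)"] by (intro that[of "min 1 (d / 2)"]) auto
  qed
  have eq: "ell2 p (1 - u) (ell2 q (1 + u) 1) = \<phi> u powr (1 / r)" for u
    using p q r s by (simp add: ell2_def \<phi>_def powr_powr flip: r_def s_def)
  have "\<phi> t powr (1 / r) < \<phi> 0 powr (1 / r)"
    using t r by (intro powr_less_mono2) (auto simp: \<phi>_def)
  then show ?thesis using that[OF t(1)] eq[of t] eq[of 0] by simp
qed

text \<open>The two sides are the norms of (f, g) before and after averaging f, for f with values 1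
  - t, 1 + t (mean 1) and g with values 0, c.\<close>

lemma ell2_averaging_increases:
  assumes p: "1 \<le> p" and q: "1 \<le> q" and pq: "p \<noteq> q"
  obtains t c where "\<bar>t\<bar> \<le> 1" "0 \<le> c" "ell2 p (1 - t) (ell2 q (1 + t) c) < ell2 p 1 (ell2 q 1 c)"
proof -
  consider "p \<noteq> \<infinity>" "q \<noteq> \<infinity>" | "p = \<infinity>" "q \<noteq> \<infinity>" | "p \<noteq> \<infinity>" "q = \<infinity>"
    using pq by auto
  then show ?thesis
  proof cases
    case 1
    then show ?thesis
      using ell2_averaging_increases_finite[OF p 1(1) q 1(2) pq] that[of _ 1] by auto
  next
    case 2
    define s where "s = enn2real q"
    have s: "1 \<le> s" unfolding s_def using enn2real_ge_1[OF q 2(2)] .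
    define R where "R = (2::real) powr (1 / s)"
    have R: "1 < R" unfolding R_def using s by (intro gr_one_powr) auto
    \<comment> \<open>With p = \<infinity> and c = 1 the averaged norm is R. Moving the first
      component by a small u lowers the l_q norm at one point below R, while the other point only
      reaches 1 + u, still below R.\<close>
    define u where "u = min (1 / 2) ((R - 1) / 2)"
    have u: "0 < u" "u \<le> 1 / 2" "1 + u < R" using R by (auto simp: u_def min_def field_simps)
    have "(1 - u) powr s < 1" using powr_less_mono2[of s "1 - u" 1] s u by simp
    then have "((1 - u) powr s + 1) powr (1 / s) < R"
      unfolding R_def using s by (intro powr_less_mono2) (auto intro: add_nonneg_nonneg)
    then have "ell2 p (1 - (- u)) (ell2 q (1 + (- u)) 1) < ell2 p 1 (ell2 q 1 1)"
      using 2 u R s by (simp add: ell2_def s_def[symmetric] R_def[symmetric])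
    then show ?thesis using u by (intro that[of "- u" 1]) auto
  next
    case 3
    define r where "r = enn2real p"
    have r: "1 \<le> r" unfolding r_def using enn2real_ge_1[OF p 3(1)] .
    \<comment> \<open>With q = \<infinity> and t = 1, the value c = 2 hides the change at the second
      point: the maximum is 2 before and after averaging. Only the first component grows, from 0 to
      1.\<close>
    have "(2 powr r) powr (1 / r) < (1 + 2 powr r) powr (1 / r)"
      using r by (intro powr_less_mono2) auto
    then have "ell2 p (1 - 1) (ell2 q (1 + 1) 2) < ell2 p 1 (ell2 q 1 2)"
      using 3 r by (simp add: ell2_def r_def[symmetric])
    then show ?thesis by (intro that[of 1 2]) auto
  qed
qed

lemma c_const_gt_1:
  fixes K :: "'k::{real_normed_field, euclidean_space} itself"
  assumes p: "1 \<le> p" and q: "1 \<le> q" and pq: "p \<noteq> q"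
  obtains a :: real where "1 < a" "ennreal a \<le> c_const K p q"
proof -
  obtain t c where t: "\<bar>t\<bar> \<le> 1" and c: "0 \<le> c"
    and less: "ell2 p (1 - t) (ell2 q (1 + t) c) < ell2 p 1 (ell2 q 1 c)"
    using ell2_averaging_increases[OF assms] .
  define f :: "bool \<Rightarrow> 'k" where "f b = of_real (if b then 1 + t else 1 - t)" for b
  define g :: "bool \<Rightarrow> 'k" where "g b = of_real (if b then c else 0)" for b
  define A where "A = pair_norm p q f g"
  define B where "B = pair_norm p q (\<lambda>_. bool_mean f) g"
  have mean: "bool_mean f = 1" by (simp add: bool_mean_def f_def)
  have A: "A = ell2 p (1 - t) (ell2 q (1 + t) c)"
    using t c by (simp add: A_def pair_norm_def f_def g_def ell2_zero_right[OF q] del: of_real_add of_real_diff)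
  have B: "B = ell2 p 1 (ell2 q 1 c)"
    using c unfolding B_def mean by (simp add: pair_norm_def g_def ell2_zero_right[OF q])
  have AB: "0 \<le> A" "A < B" using less A B pair_norm_nonneg[of p q f g] by (auto simp: A_def)
  \<comment> \<open>The ratio B/A bounds every admissible C from below. The value 2 guards the
    division: with A = 0 < B no C would be admissible.\<close>
  define a where "a = (if A = 0 then 2 else B / A)"
  have "ennreal a \<le> c_const K p q"
    unfolding c_const_eq[OF p]
  proof (rule Inf_greatest, clarify)
    fix C :: real
    assume C: "0 \<le> C" "\<forall>f g :: bool \<Rightarrow> 'k. pair_norm p q (\<lambda>_. bool_mean f) g \<le> C * pair_norm p q f g"
    have "B \<le> C * A" using C(2) by (simp add: A_def B_def)
    then have "a \<le> C" using AB by (auto simp: a_def field_simps)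
    then show "ennreal a \<le> ennreal C" by (rule ennreal_leI)
  qed
  moreover have "1 < a" using AB by (auto simp: a_def field_simps)
  ultimately show ?thesis by (rule that[rotated])
qed

section \<open>Conditional expectations and independent signs\<close>

lemma Lnorm_1: "Lnorm M 1 h = (\<integral>\<^sup>+ x. ennreal \<bar>h x\<bar> \<partial>M)"
  by (simp add: Lnorm_def Let_def less_top)

lemma Lnorm_le_bound:
  assumes "prob_space M" and s: "1 < s" and R: "0 \<le> R" and bound: "AE x in M. \<bar>h x\<bar> \<le> R"
  shows "Lnorm M (ennreal s) h \<le> ennreal R"
proof -
  interpret prob_space M by fact
  let ?I = "\<integral>\<^sup>+ x. ennreal (\<bar>h x\<bar> powr s) \<partial>M"
  have "?I \<le> (\<integral>\<^sup>+ x. ennreal (R powr s) \<partial>M)"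
    using bound s by (intro nn_integral_mono_AE) (auto elim!: eventually_mono intro!: ennreal_leI powr_mono2)
  then have I: "?I \<le> ennreal (R powr s)" by (simp add: emeasure_space_1)
  then have "enn2real ?I \<le> R powr s" by (simp add: enn2real_leI)
  then have "enn2real ?I powr (1 / s) \<le> (R powr s) powr (1 / s)"
    using s by (intro powr_mono2) auto
  then have "enn2real ?I powr (1 / s) \<le> R" using s R by (simp add: powr_powr)
  moreover have "?I \<noteq> \<infinity>" using I by (auto simp: top_unique)
  ultimately show ?thesis using s by (simp add: Lnorm_def Let_def ennreal_leI)
qed

text \<open>Jensen's inequality: integrate the tangent line of y^s at the mean a of |h|, whose
  linear part has integral 0. Integrability of |h| comes from |y| \<le> 1 + |y|^s.\<close>

lemma Lnorm_1_le:
  assumes "prob_space M" and s: "1 < s" and [measurable]: "h \<in> borel_measurable M"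
  shows "Lnorm M 1 h \<le> Lnorm M (ennreal s) h"
proof (cases "(\<integral>\<^sup>+ x. ennreal (\<bar>h x\<bar> powr s) \<partial>M) = \<infinity>")
  case False
  interpret prob_space M by fact
  define I where "I = (\<integral> x. \<bar>h x\<bar> powr s \<partial>M)"
  have int_s: "integrable M (\<lambda>x. \<bar>h x\<bar> powr s)"
    using False by (intro integrableI_nonneg) (auto simp: less_top)
  have I: "(\<integral>\<^sup>+ x. ennreal (\<bar>h x\<bar> powr s) \<partial>M) = ennreal I" "0 \<le> I"
    unfolding I_def using nn_integral_eq_integral[OF int_s] by auto
  have le: "\<bar>y\<bar> \<le> 1 + \<bar>y\<bar> powr s" for y :: real
    using powr_mono[of 1 s "\<bar>y\<bar>"] s by (cases "\<bar>y\<bar> \<le> 1") (auto intro: add_increasing2)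
  have int_1: "integrable M (\<lambda>x. \<bar>h x\<bar>)"
    by (rule Bochner_Integration.integrable_bound[where f = "\<lambda>x. 1 + \<bar>h x\<bar> powr s"])
       (use int_s le in auto)
  define a where "a = (\<integral> x. \<bar>h x\<bar> \<partial>M)"
  have a: "0 \<le> a" by (simp add: a_def)
  have "a \<le> I powr (1 / s)"
  proof (cases "a = 0")
    case False
    then have a: "0 < a" using a by simp
    have tangent: "a powr s + s * a powr (s - 1) * (y - a) \<le> y powr s" if "0 \<le> y" for y
    proof (cases "y = 0")
      case True
      have "a powr s = a * a powr (s - 1)" using a by (simp add: powr_diff)
      then show ?thesis using True s a by (simp add: algebra_simps)
    next
      case False
      then have "s * a powr (s - 1) * (y - a) \<le> y powr s - a powr s"
        using powr_convex[of s] a s that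
        by (intro convex_on_imp_above_tangent[where A = "{0<..}"])
           (auto simp: interior_open intro!: has_field_derivative_at_within has_real_derivative_powr)
      then show ?thesis by simp
    qed
    have "(\<integral> x. a powr s + s * a powr (s - 1) * (\<bar>h x\<bar> - a) \<partial>M) \<le> I"
      unfolding I_def using int_1 int_s tangent by (intro integral_mono) auto
    then have "a powr s \<le> I"
      using int_1 by (simp add: prob_space a_def[symmetric])
    then have "(a powr s) powr (1 / s) \<le> I powr (1 / s)" using s by (intro powr_mono2) auto
    then show ?thesis using a s by (simp add: powr_powr)
  qed (simp add: I)
  then show ?thesis
    using s I nn_integral_eq_integral[OF int_1] by (simp add: Lnorm_1 Lnorm_def Let_def a_def ennreal_leI)
qed (use s in \<open>simp add: Lnorm_def Let_def\<close>)

text \<open>Used to place martingale differences in L_s: only the existence of some bound matters,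
  and it passes easily to differences and conditional expectations.\<close>

definition ess_bounded :: "'x measure \<Rightarrow> ('x \<Rightarrow> 'b::real_normed_vector) \<Rightarrow> bool" where
  "ess_bounded M u \<longleftrightarrow> (\<exists>R. AE x in M. norm (u x) \<le> R)"

lemma ess_bounded_zero: "ess_bounded M (\<lambda>_. 0)"
  by (auto simp: ess_bounded_def intro: exI[of _ 0])

lemma ess_bounded_diff:
  assumes "ess_bounded M u" "ess_bounded M v"
  shows "ess_bounded M (\<lambda>x. u x - v x)"
proof -
  obtain R R' where "AE x in M. norm (u x) \<le> R" "AE x in M. norm (v x) \<le> R'"
    using assms by (auto simp: ess_bounded_def)
  then have "AE x in M. norm (u x - v x) \<le> R + R'"
    by eventually_elim (metis add_mono norm_triangle_le_diff)
  then show ?thesis by (auto simp: ess_bounded_def)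
qed

lemma ess_bounded_Lnorm:
  assumes "Lnorm M \<infinity> (\<lambda>x. norm (u x)) < \<infinity>"
  shows "ess_bounded M u"
proof -
  define c where "c = Lnorm M \<infinity> (\<lambda>x. norm (u x))"
  have AE: "AE x in M. ennreal (norm (u x)) \<le> c"
    using esssup_AE[of "\<lambda>x. ennreal \<bar>norm (u x)\<bar>" M] by (simp add: c_def Lnorm_def)
  obtain R where "0 \<le> R" "c = ennreal R"
    using assms by (cases c) (auto simp: c_def)
  then show ?thesis using AE by (auto simp: ess_bounded_def)
qed

text \<open>Assembled from \<open>real_cond_exp\<close> of the coordinates in the Euclidean basis.
  The definition of S provides versions for \<theta> k given A k only; the martingale also needs
  \<theta> j given A k for k different from j.\<close>

lemma exists_cond_exp:
  fixes f :: "'x \<Rightarrow> 'b::euclidean_space"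
  assumes "prob_space M" and sub: "subalgebra M F" and int: "integrable M f"
  shows "\<exists>g. is_cond_exp M F f g"
proof -
  interpret prob_space M by fact
  interpret finite_measure_subalgebra M F by unfold_locales (rule sub)
  define g where "g x = (\<Sum>b\<in>Basis. real_cond_exp M F (\<lambda>x. f x \<bullet> b) x *\<^sub>R b)" for x
  have intb: "integrable M (\<lambda>x. f x \<bullet> b)" for b using int by simp
  have "integrable M g" unfolding g_def
    by (intro Bochner_Integration.integrable_sum integrable_scaleR_left real_cond_exp_int intb)
  moreover have "g \<in> borel_measurable F" unfolding g_def by measurable
  moreover have "set_lebesgue_integral M A f = set_lebesgue_integral M A g" if A: "A \<in> sets F" for A
  proof -
    have AM: "A \<in> sets M" using A sub by (auto simp: subalgebra_def)
    have int': "integrable M (\<lambda>x. indicator A x *\<^sub>R u x)" if "integrable M u" for u :: "'x \<Rightarrow> real"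
      using that AM by (rule integrable_mult_indicator[rotated])
    have "set_lebesgue_integral M A f = (\<integral>x. (\<Sum>b\<in>Basis. (indicator A x *\<^sub>R (f x \<bullet> b)) *\<^sub>R b) \<partial>M)"
      unfolding set_lebesgue_integral_def
      by (intro Bochner_Integration.integral_cong refl)
         (simp add: euclidean_representation scaleR_sum_right[symmetric] flip: scaleR_scaleR)
    also have "\<dots> = (\<Sum>b\<in>Basis. set_lebesgue_integral M A (\<lambda>x. f x \<bullet> b) *\<^sub>R b)"
      unfolding set_lebesgue_integral_def
      using int'[OF intb] by (subst Bochner_Integration.integral_sum) auto
    also have "\<dots> = (\<Sum>b\<in>Basis. set_lebesgue_integral M A (real_cond_exp M F (\<lambda>x. f x \<bullet> b)) *\<^sub>R b)"
      using real_cond_exp_intA[OF intb A] by simp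
    also have "\<dots> = (\<integral>x. (\<Sum>b\<in>Basis. (indicator A x *\<^sub>R real_cond_exp M F (\<lambda>x. f x \<bullet> b) x) *\<^sub>R b) \<partial>M)"
      unfolding set_lebesgue_integral_def
      using int'[OF real_cond_exp_int(1)[OF intb]] by (subst Bochner_Integration.integral_sum) auto
    also have "\<dots> = set_lebesgue_integral M A g"
      unfolding set_lebesgue_integral_def g_def
      by (intro Bochner_Integration.integral_cong refl)
         (simp add: scaleR_sum_right[symmetric] flip: scaleR_scaleR)
    finally show ?thesis .
  qed
  ultimately show ?thesis using int by (auto simp: is_cond_exp_def)
qed

text \<open>By a.e. uniqueness each coordinate of the given version agrees with a
  \<open>real_cond_exp\<close>, which stays between -R and R.\<close>

lemma ess_bounded_cond_exp:
  fixes f :: "'x \<Rightarrow> 'b::euclidean_space"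
  assumes "prob_space M" and sub: "subalgebra M F" and ce: "is_cond_exp M F f g" and "ess_bounded M f"
  shows "ess_bounded M g"
proof -
  interpret prob_space M by fact
  interpret finite_measure_subalgebra M F by unfold_locales (rule sub)
  obtain R where R: "AE x in M. norm (f x) \<le> R" using assms(4) by (auto simp: ess_bounded_def)
  have int: "integrable M f" "integrable M g" "g \<in> borel_measurable F"
    using ce by (auto simp: is_cond_exp_def)
  have "AE x in M. \<bar>g x \<bullet> b\<bar> \<le> R" if b: "b \<in> Basis" for b
  proof -
    have fb: "AE x in M. \<bar>f x \<bullet> b\<bar> \<le> R"
      using R by eventually_elim (use Basis_le_norm[OF b] in \<open>auto intro: order_trans\<close>)
    have intb: "integrable M (\<lambda>x. f x \<bullet> b)" "integrable M (\<lambda>x. g x \<bullet> b)" using int by simp_all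
    have set: "set_lebesgue_integral M A (\<lambda>x. u x \<bullet> b) = set_lebesgue_integral M A u \<bullet> b"
      if "integrable M u" "A \<in> sets F" for A and u :: "'x \<Rightarrow> 'b"
    proof -
      have "A \<in> sets M" using that sub by (auto simp: subalgebra_def)
      then have "integrable M (\<lambda>x. indicator A x *\<^sub>R u x)"
        using that by (intro integrable_mult_indicator)
      then show ?thesis
        unfolding set_lebesgue_integral_def by (simp flip: integral_inner_left)
    qed
    have "AE x in M. real_cond_exp M F (\<lambda>x. f x \<bullet> b) x = g x \<bullet> b"
      using int ce by (intro real_cond_exp_charact intb) (auto simp: set is_cond_exp_def)
    moreover have "AE x in M. real_cond_exp M F (\<lambda>x. f x \<bullet> b) x \<le> R"
      using fb by (intro real_cond_exp_le_c intb) (auto elim!: eventually_mono)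
    moreover have "AE x in M. real_cond_exp M F (\<lambda>x. f x \<bullet> b) x \<ge> - R"
      using fb by (intro real_cond_exp_ge_c intb) (auto elim!: eventually_mono)
    ultimately show ?thesis by eventually_elim auto
  qed
  then have "AE x in M. \<forall>b\<in>Basis. \<bar>g x \<bullet> b\<bar> \<le> R" by (intro AE_finite_allI) auto
  then have "AE x in M. norm (g x) \<le> (\<Sum>b\<in>(Basis :: 'b set). R)"
    by eventually_elim (rule order_trans[OF norm_le_l1], rule sum_mono, simp)
  then show ?thesis by (auto simp: ess_bounded_def)
qed

lemma ess_bounded_E_norm_fun:
  fixes d :: "(bool \<times> bool) list \<Rightarrow> 'x \<Rightarrow> 'k::real_normed_field"
  assumes "\<And>w. w \<in> E_index N \<Longrightarrow> ess_bounded M (d w)"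
  shows "ess_bounded M (\<lambda>x. E_norm_fun p q N (\<lambda>w. d w x))"
proof -
  have "\<forall>w\<in>E_index N. \<exists>R. AE x in M. norm (d w x) \<le> R" using assms by (simp add: ess_bounded_def)
  then obtain R where "\<And>w. w \<in> E_index N \<Longrightarrow> AE x in M. norm (d w x) \<le> R w" by metis
  then have "AE x in M. \<forall>w\<in>E_index N. norm (d w x) \<le> R w"
    by (intro AE_finite_allI finite_E_index)
  then have "AE x in M. norm (E_norm_fun p q N (\<lambda>w. d w x)) \<le> E_norm_fun p q N (\<lambda>w. of_real (R w) :: 'k)"
  proof eventually_elim
    case (elim x)
    then show ?case
      by (auto simp: E_norm_fun_nonneg E_index_def intro!: E_norm_fun_mono order_trans[OF _ abs_ge_self])
  qed
  then show ?thesis by (auto simp: ess_bounded_def)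
qed

section \<open>Independent signs and product filtrations\<close>

definition sgn_coord :: "nat \<Rightarrow> nat set \<Rightarrow> real" where
  "sgn_coord j S = (if j \<in> S then 1 else -1)"

text \<open>A pattern of signs at the positions 0 to n is coded by the set of positions with sign
  +1; under the uniform measure these signs are independent and symmetric.\<close>

definition signs :: "nat \<Rightarrow> nat set measure" where
  "signs n = uniform_count_measure (Pow {..n})"

definition sign_filtration :: "nat \<Rightarrow> nat \<Rightarrow> nat set measure" where
  "sign_filtration n t = vimage_algebra (Pow {..n}) (\<lambda>S. S \<inter> {..<t}) (count_space UNIV)"

lemma abs_sgn_coord: "\<bar>sgn_coord j S\<bar> = 1"
  by (simp add: sgn_coord_def)

lemma space_signs: "space (signs n) = Pow {..n}"
  and sets_signs: "sets (signs n) = Pow (Pow {..n})"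
  by (simp_all add: signs_def space_uniform_count_measure sets_uniform_count_measure)

lemma space_sign_filtration: "space (sign_filtration n t) = Pow {..n}"
  by (simp add: sign_filtration_def)

lemma sets_sign_filtration:
  "sets (sign_filtration n t) = {(\<lambda>S. S \<inter> {..<t}) -` B \<inter> Pow {..n} | B. True}"
  by (simp add: sign_filtration_def sets_vimage_algebra2)

lemma prob_space_signs: "prob_space (signs n)"
  unfolding signs_def by (intro prob_space_uniform_count_measure) auto

lemma subalgebra_sign_filtration: "subalgebra (signs n) (sign_filtration n t)"
  by (auto simp: subalgebra_def space_signs sets_signs space_sign_filtration sets_sign_filtration)

lemma sets_sign_filtration_mono:
  assumes "t \<le> u"
  shows "sets (sign_filtration n t) \<subseteq> sets (sign_filtration n u)"
proof
  fix A assume "A \<in> sets (sign_filtration n t)"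
  then obtain B where "A = (\<lambda>S. S \<inter> {..<t}) -` B \<inter> Pow {..n}" by (auto simp: sets_sign_filtration)
  moreover have inter: "S \<inter> {..<u} \<inter> {..<t} = S \<inter> {..<t}" for S using assms by auto
  ultimately have "A = (\<lambda>S. S \<inter> {..<u}) -` ((\<lambda>S. S \<inter> {..<t}) -` B) \<inter> Pow {..n}"
    by (simp only: vimage_def mem_Collect_eq inter)
  then show "A \<in> sets (sign_filtration n u)" by (auto simp: sets_sign_filtration)
qed

lemma borel_measurable_sgn_coord:
  assumes "j < t"
  shows "sgn_coord j \<in> borel_measurable (sign_filtration n t)"
proof -
  have "(\<lambda>S. S \<inter> {..<t}) \<in> measurable (sign_filtration n t) (count_space UNIV)"
    unfolding sign_filtration_def by (rule measurable_vimage_algebra1) simp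
  then have "(\<lambda>S. sgn_coord j (S \<inter> {..<t})) \<in> borel_measurable (sign_filtration n t)"
    by (rule measurable_compose) simp
  moreover have "sgn_coord j (S \<inter> {..<t}) = sgn_coord j S" for S
    using assms by (simp add: sgn_coord_def)
  ultimately show ?thesis by simp
qed

text \<open>Patterns cancel in pairs \<open>S\<close>, \<open>insert j S\<close>, which differ only
  in the sign at j.\<close>

lemma sum_sgn_coord_eq_0:
  fixes \<Phi> :: "nat set \<Rightarrow> 'b::real_vector"
  assumes j: "j \<le> n" and \<Phi>: "\<And>S. S \<subseteq> {..n} \<Longrightarrow> j \<notin> S \<Longrightarrow> \<Phi> (insert j S) = \<Phi> S"
  shows "(\<Sum>S\<in>Pow {..n}. sgn_coord j S *\<^sub>R \<Phi> S) = 0"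
proof -
  have eq: "Pow {..n} = Pow ({..n} - {j}) \<union> insert j ` Pow ({..n} - {j})"
  proof -
    have "{..n} = insert j ({..n} - {j})" using j by auto
    then show ?thesis by (metis Pow_insert)
  qed
  have "inj_on (insert j) (Pow ({..n} - {j}))"
    by (rule inj_onI) blast
  then have "(\<Sum>S\<in>Pow {..n}. sgn_coord j S *\<^sub>R \<Phi> S)
      = (\<Sum>S\<in>Pow ({..n} - {j}). sgn_coord j S *\<^sub>R \<Phi> S)
        + (\<Sum>S\<in>Pow ({..n} - {j}). sgn_coord j (insert j S) *\<^sub>R \<Phi> (insert j S))"
    unfolding eq by (subst sum.union_disjoint) (auto simp: sum.reindex)
  also have "\<dots> = (\<Sum>S\<in>Pow ({..n} - {j}). sgn_coord j S *\<^sub>R \<Phi> S + sgn_coord j (insert j S) *\<^sub>R \<Phi> (insert j S))"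
    by (simp add: sum.distrib)
  also have "\<dots> = 0"
  proof (rule sum.neutral, rule ballI)
    fix S assume "S \<in> Pow ({..n} - {j})"
    then have "S \<subseteq> {..n}" "j \<notin> S" by auto
    then show "sgn_coord j S *\<^sub>R \<Phi> S + sgn_coord j (insert j S) *\<^sub>R \<Phi> (insert j S) = 0"
      using \<Phi>[of S] by (simp add: sgn_coord_def)
  qed
  finally show ?thesis .
qed

lemma sets_pair_measure_mono:
  assumes "space A = space A'" "space B = space B'" "sets A \<subseteq> sets A'" "sets B \<subseteq> sets B'"
  shows "sets (A \<Otimes>\<^sub>M B) \<subseteq> sets (A' \<Otimes>\<^sub>M B')"
  unfolding sets_pair_measure assms(1,2) using assms(3,4) by (intro sigma_sets_mono') blast

lemma subalgebra_pair_measure: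
  assumes "subalgebra M F" "subalgebra Q V"
  shows "subalgebra (M \<Otimes>\<^sub>M Q) (F \<Otimes>\<^sub>M V)"
  using assms sets_pair_measure_mono[of F M V Q] by (simp add: subalgebra_def space_pair_measure)

lemma AE_fst_signs:
  assumes "AE x in M. P x"
  shows "AE z in M \<Otimes>\<^sub>M signs n. P (fst z)"
proof -
  interpret prob_space "signs n" by (rule prob_space_signs)
  show ?thesis
    by (rule AE_distrD[where M' = M and f = fst]) (simp_all only: measurable_fst distr_pair_fst assms)
qed

lemma ess_bounded_signs:
  assumes "ess_bounded M u"
  shows "ess_bounded (M \<Otimes>\<^sub>M signs n) (\<lambda>z. sgn_coord j (snd z) *\<^sub>R u (fst z))"
proof -
  obtain R where "AE x in M. norm (u x) \<le> R" using assms by (auto simp: ess_bounded_def)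
  then have "AE z in M \<Otimes>\<^sub>M signs n. norm (u (fst z)) \<le> R" by (rule AE_fst_signs)
  then show ?thesis by (auto simp: ess_bounded_def abs_sgn_coord)
qed

text \<open>A sign that the filtration has not revealed yet, or a factor of mean zero, annihilates the
  conditional expectation.\<close>

lemma is_cond_exp_signs:
  fixes u :: "'x \<Rightarrow> 'b::euclidean_space"
  assumes "prob_space M" and sub: "subalgebra M F" and int: "integrable M u" and j: "j \<le> n"
    and zero: "t \<le> j \<or> (\<forall>B\<in>sets F. set_lebesgue_integral M B u = 0)"
  shows "is_cond_exp (M \<Otimes>\<^sub>M signs n) (F \<Otimes>\<^sub>M sign_filtration n t)
           (\<lambda>z. sgn_coord j (snd z) *\<^sub>R u (fst z)) (\<lambda>_. 0)"
proof -
  interpret M: prob_space M by fact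
  interpret Q: prob_space "signs n" by (rule prob_space_signs)
  interpret PS: pair_sigma_finite M "signs n" ..
  let ?P = "M \<Otimes>\<^sub>M signs n"
  let ?G = "F \<Otimes>\<^sub>M sign_filtration n t"
  let ?f = "\<lambda>z. sgn_coord j (snd z) *\<^sub>R u (fst z)"
  have [measurable]: "u \<in> borel_measurable M" using int by simp
  have [measurable]: "sgn_coord j \<in> borel_measurable (signs n)"
    by (rule measurable_from_subalg[OF subalgebra_sign_filtration borel_measurable_sgn_coord[of j "Suc j"]]) simp
  have "integrable ?P (\<lambda>z. u (fst z))"
    by (rule integrable_distr[where M' = M]) (simp_all add: Q.distr_pair_fst int)
  then have intf: "integrable ?P ?f"
    by (rule Bochner_Integration.integrable_bound) (auto simp: abs_sgn_coord)
  have "set_lebesgue_integral ?P D ?f = 0" if D: "D \<in> sets ?G" for D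
  proof -
    have DP [measurable]: "D \<in> sets ?P"
      using D subalgebra_pair_measure[OF sub subalgebra_sign_filtration, of n t] by (auto simp: subalgebra_def)
    \<comment> \<open>By Fubini the integral over D is the signed average over S of the integrals of
      u over the sections of D.\<close>
    define \<Phi> where "\<Phi> S = set_lebesgue_integral M ((\<lambda>x. (x, S)) -` D) u" for S
    have sec: "(\<lambda>x. (x, S)) -` D \<in> sets F" for S using sets_Pair2[OF D] .
    have "set_lebesgue_integral ?P D ?f
        = (\<integral>z. (\<lambda>(x, S). sgn_coord j S *\<^sub>R (indicator ((\<lambda>x. (x, S)) -` D) x *\<^sub>R u x)) z \<partial>?P)"
      unfolding set_lebesgue_integral_def
      by (intro Bochner_Integration.integral_cong refl) (auto simp: indicator_def)
    also have "\<dots> = (\<integral>S. \<integral>x. sgn_coord j S *\<^sub>R (indicator ((\<lambda>x. (x, S)) -` D) x *\<^sub>R u x) \<partial>M \<partial>signs n)"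
    proof (rule PS.integral_snd[symmetric])
      have "integrable ?P (\<lambda>z. indicator D z *\<^sub>R ?f z)"
        using DP intf by (rule integrable_mult_indicator)
      moreover have "(\<lambda>z. indicator D z *\<^sub>R ?f z)
          = (\<lambda>(x, S). sgn_coord j S *\<^sub>R (indicator ((\<lambda>x. (x, S)) -` D) x *\<^sub>R u x))"
        by (auto simp: indicator_def)
      ultimately show "integrable ?P (\<lambda>(x, S). sgn_coord j S *\<^sub>R (indicator ((\<lambda>x. (x, S)) -` D) x *\<^sub>R u x))"
        by simp
    qed
    also have "\<dots> = (\<integral>S. sgn_coord j S *\<^sub>R \<Phi> S \<partial>signs n)"
      by (simp only: \<Phi>_def set_lebesgue_integral_def integral_scaleR_right)
    also have "\<dots> = (\<Sum>S\<in>Pow {..n}. (1 / card (Pow {..n})) *\<^sub>R (sgn_coord j S *\<^sub>R \<Phi> S))"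
      unfolding signs_def uniform_count_measure_def
      by (subst lebesgue_integral_point_measure_finite) auto
    also have "\<dots> = 0"
    proof (cases "t \<le> j")
      case True
      \<comment> \<open>The sign at j is not yet revealed, so D has the same section at S and at
        \<open>insert j S\<close>, and the pairs cancel.\<close>
      have "\<Phi> (insert j S) = \<Phi> S" if S: "S \<subseteq> {..n}" for S
      proof -
        have "(x, insert j S) \<in> D \<longleftrightarrow> (x, S) \<in> D" for x
        proof -
          have "Pair x -` D \<in> sets (sign_filtration n t)" using sets_Pair1[OF D] .
          then obtain B where "Pair x -` D = (\<lambda>S. S \<inter> {..<t}) -` B \<inter> Pow {..n}"
            by (auto simp: sets_sign_filtration)
          moreover have "insert j S \<inter> {..<t} = S \<inter> {..<t}" using True by auto
          ultimately have "insert j S \<in> Pair x -` D \<longleftrightarrow> S \<in> Pair x -` D" using S j by auto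
          then show ?thesis by simp
        qed
        then have "(\<lambda>x. (x, insert j S)) -` D = (\<lambda>x. (x, S)) -` D" by auto
        then show ?thesis by (simp add: \<Phi>_def)
      qed
      then have "(\<Sum>S\<in>Pow {..n}. sgn_coord j S *\<^sub>R \<Phi> S) = 0"
        by (intro sum_sgn_coord_eq_0[OF j])
      then show ?thesis by (simp only: scaleR_sum_right[symmetric] scaleR_zero_right)
    next
      case False
      then have "\<Phi> S = 0" for S using zero sec[of S] by (simp add: \<Phi>_def)
      then show ?thesis by simp
    qed
    finally show ?thesis .
  qed
  then show ?thesis using intf by (simp add: is_cond_exp_def set_lebesgue_integral_def)
qed

section \<open>The UMD constant dominates $S$\<close>

text \<open>Brings the product with sign patterns back into \<open>'w\<close> by cardinal
  arithmetic. The second factor is cut down to a finite set because all of \<open>nat set\<close>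
  may be larger than \<open>'w\<close>.\<close>

lemma infinite_embeds_Times:
  assumes inf: "infinite (UNIV :: 'w set)" and B: "finite B"
  obtains h :: "'w \<times> 'b \<Rightarrow> 'w" where "inj_on h (UNIV \<times> B)"
proof (cases "B = {}")
  case False
  obtain f :: "nat \<Rightarrow> 'w" where f: "inj f"
    using inf infinite_iff_countable_subset[of "UNIV :: 'w set"] by auto
  obtain e :: "'b \<Rightarrow> nat" where "inj_on e B" using finite_imp_inj_to_nat_seg[OF B] by blast
  then have "inj_on (f \<circ> e) B" using f by (intro comp_inj_on) (auto intro: inj_on_subset)
  then have le: "\<exists>g :: 'b \<Rightarrow> 'w. inj_on g B \<and> g ` B \<subseteq> UNIV" by blast
  have "\<exists>h :: 'w \<times> 'b \<Rightarrow> 'w. bij_betw h (UNIV \<times> B) UNIV"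
    using card_of_Times_infinite[OF inf False le[unfolded card_of_ordLeq]] card_of_ordIso by blast
  then show ?thesis using that by (auto simp: bij_betw_def)
qed (use that in simp)

text \<open>The martingale of \<open>\<Sum>j. \<epsilon>\<^sub>j \<theta>\<^sub>j x\<^sub>j\<close>: time \<open>2k\<close> knows \<open>A\<^sub>k\<close> and the signs before \<open>k\<close>, time
  \<open>2k + 1\<close> in addition knows the sign \<open>k\<close>. The increments at odd times are \<open>\<epsilon>\<^sub>k E(\<theta>\<^sub>k | A\<^sub>k) x\<^sub>k\<close>.\<close>

definition sgn_mart ::
    "(nat \<Rightarrow> nat \<Rightarrow> 'x \<Rightarrow> 'b::real_vector) \<Rightarrow> nat \<Rightarrow> nat \<Rightarrow> 'x \<times> nat set \<Rightarrow> 'b" where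
  "sgn_mart E m j z = (if 2 * j < m then sgn_coord j (snd z) *\<^sub>R E (m div 2) j (fst z) else 0)"

definition sgn_mart_diff ::
    "(nat \<Rightarrow> nat \<Rightarrow> 'x \<Rightarrow> 'b::real_vector) \<Rightarrow> nat \<Rightarrow> nat \<Rightarrow> 'x \<times> nat set \<Rightarrow> 'b" where
  "sgn_mart_diff E m j z = (case m of 0 \<Rightarrow> 0 | Suc m' \<Rightarrow> sgn_mart E m j z - sgn_mart E m' j z)"

lemma sum_sgn_mart_diff: "(\<Sum>m\<le>k. sgn_mart_diff E m j z) = sgn_mart E k j z"
  by (induction k) (simp_all add: sgn_mart_diff_def sgn_mart_def)

lemma sgn_mart_diff_odd:
  "sgn_mart_diff E (Suc (2 * k)) j z = (if j = k then sgn_coord k (snd z) *\<^sub>R E k k (fst z) else 0)"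
  by (auto simp: sgn_mart_diff_def sgn_mart_def)

text \<open>Even increments carry only revealed signs; the other factor is a difference of
  successive conditional expectations, the mean-zero alternative in
  \<open>is_cond_exp_signs\<close>.\<close>

lemma sgn_mart_diff_even:
  "sgn_mart_diff E (Suc (Suc (2 * k))) j z =
     (if j \<le> k then sgn_coord j (snd z) *\<^sub>R (E (Suc k) j (fst z) - E k j (fst z)) else 0)"
  by (auto simp: sgn_mart_diff_def sgn_mart_def scaleR_diff_right)

text \<open>Adding the transform with sign +1 at odd and -1 at even times cancels the even
  increments and doubles the odd ones.\<close>

lemma sum_sgn_mart_diff_alternating:
  "(\<Sum>m\<le>2 * k. sgn_mart_diff E m j z + (if odd m then 1 else -1) *\<^sub>R sgn_mart_diff E m j z)
     = (if j < k then 2 *\<^sub>R (sgn_coord j (snd z) *\<^sub>R E j j (fst z)) else 0)"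
proof (induction k)
  case (Suc k)
  have "2 * Suc k = Suc (Suc (2 * k))" by simp
  then show ?case
    using Suc by (auto simp: sgn_mart_diff_odd scaleR_2 less_Suc_eq simp del: scaleR_scaleR)
qed (simp add: sgn_mart_diff_def)

lemma umd_bound_imp_S_bound:
  fixes W :: "'w itself"
  assumes p: "1 \<le> p" and q: "1 \<le> q" and s: "1 < s" and inf: "infinite (UNIV :: 'w set)"
    and C: "umd_bound W (E_space N :: ((bool \<times> bool) list \<Rightarrow>\<^sub>0 'k::{real_normed_field, euclidean_space}) set)
      (E_norm p q N) s C"
  shows "S_bound W (E_scale :: 'k \<Rightarrow> _) (E_norm p q N) (E_index N) E_basis C"
  unfolding S_bound_def
proof (intro allI impI, elim conjE)
  fix M :: "'w measure" and A :: "nat \<Rightarrow> 'w measure" and n :: nat and i :: "nat \<Rightarrow> (bool \<times> bool) list"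
    and \<theta> g :: "nat \<Rightarrow> 'w \<Rightarrow> 'k"
  assume filt: "filtered_prob_space M A" and inj: "inj_on i {..n}" and ran: "i ` {..n} \<subseteq> E_index N"
    and \<theta>: "\<forall>k\<le>n. \<theta> k \<in> borel_measurable M \<and> Lnorm M \<infinity> (\<lambda>w. norm (\<theta> k w)) < \<infinity> \<and>
                is_cond_exp M (A k) (\<theta> k) (g k)"
  interpret M: prob_space M using filt by (simp add: filtered_prob_space_def)
  interpret Q: prob_space "signs n" by (rule prob_space_signs)
  interpret P: pair_prob_space M "signs n" ..
  have sub: "subalgebra M (A k)" for k using filt by (simp add: filtered_prob_space_def)
  have mono: "sets (A k) \<subseteq> sets (A l)" if "k \<le> l" for k l
    using filt that by (auto simp: filtered_prob_space_def filtration_def)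
  \<comment> \<open>After time n the full sigma-algebra is appended, so that the martingale ends at
    \<theta> itself.\<close>
  define B where "B k = (if k \<le> n then A k else M)" for k
  have subB: "subalgebra M (B k)" for k using sub by (simp add: B_def subalgebra_def)
  have monoB: "sets (B k) \<subseteq> sets (B l)" if "k \<le> l" for k l
    using that mono sub by (auto simp: B_def subalgebra_def)
  have int\<theta>: "integrable M (\<theta> j)" if "j \<le> n" for j using \<theta> that by (auto simp: is_cond_exp_def)
  \<comment> \<open>On the diagonal the prescribed version \<open>g j\<close> is chosen, so that the
    odd increments contain g pointwise; past n the value is \<theta> j, and elsewhere any version
    serves.\<close>
  define E where "E k j = (if n < k then \<theta> j else if k = j then g j else (SOME e. is_cond_exp M (A k) (\<theta> j) e))"
    for k j
  have E: "is_cond_exp M (B k) (\<theta> j) (E k j)" if j: "j \<le> n" for k j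
  proof -
    have "is_cond_exp M (A k) (\<theta> j) (SOME e. is_cond_exp M (A k) (\<theta> j) e)"
      by (rule someI_ex[OF exists_cond_exp[OF M.prob_space_axioms sub int\<theta>[OF j]]])
    moreover have "is_cond_exp M (A j) (\<theta> j) (g j)" using \<theta> j by simp
    moreover have "is_cond_exp M M (\<theta> j) (\<theta> j)" using int\<theta>[OF j] by (simp add: is_cond_exp_def)
    ultimately show ?thesis by (simp add: E_def B_def)
  qed
  have bddE: "ess_bounded M (E k j)" if j: "j \<le> n" for k j
    using \<theta> j by (intro ess_bounded_cond_exp[OF M.prob_space_axioms subB E[OF j]] ess_bounded_Lnorm) auto
  let ?P = "M \<Otimes>\<^sub>M signs n"
  \<comment> \<open>The rounding differs on purpose: from time 2k to 2k + 1 only the sign at k is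
    added, from 2k + 1 to 2k + 2 only the step from \<open>B k\<close> to
    \<open>B (Suc k)\<close>.\<close>
  define G where "G m = B (m div 2) \<Otimes>\<^sub>M sign_filtration n (Suc m div 2)" for m
  have subG: "subalgebra ?P (G m)" for m
    unfolding G_def by (rule subalgebra_pair_measure[OF subB subalgebra_sign_filtration])
  have monoG: "sets (G m) \<subseteq> sets (G m')" if "m \<le> m'" for m m'
    unfolding G_def
  proof (rule sets_pair_measure_mono)
    show "space (B (m div 2)) = space (B (m' div 2))" using subB by (simp add: subalgebra_def)
    show "sets (B (m div 2)) \<subseteq> sets (B (m' div 2))" using that by (intro monoB div_le_mono)
    show "sets (sign_filtration n (Suc m div 2)) \<subseteq> sets (sign_filtration n (Suc m' div 2))"
      using that by (intro sets_sign_filtration_mono div_le_mono) simp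
  qed (simp add: space_sign_filtration)
  have filtG: "filtered_prob_space ?P G"
    using P.prob_space_axioms subG monoG by (simp add: filtered_prob_space_def filtration_def subalgebra_def)
  have meas_mart: "sgn_mart E m j \<in> borel_measurable (G m)" if j: "j \<le> n" for m j
  proof (cases "2 * j < m")
    case True
    have [measurable]: "E (m div 2) j \<in> borel_measurable (B (m div 2))"
      using E[OF j] by (simp add: is_cond_exp_def)
    have [measurable]: "sgn_coord j \<in> borel_measurable (sign_filtration n (Suc m div 2))"
      using True by (intro borel_measurable_sgn_coord) linarith
    show ?thesis using True unfolding sgn_mart_def[abs_def] G_def by simp
  qed (simp add: sgn_mart_def[abs_def])
  have meas_diff: "sgn_mart_diff E m j \<in> borel_measurable (G m)" if j: "j \<le> n" for m j
  proof (cases m)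
    case (Suc m')
    have "subalgebra (G m) (G m')"
      using subG[of m] subG[of m'] monoG[of m' m] Suc by (simp add: subalgebra_def)
    then have "sgn_mart E m' j \<in> borel_measurable (G m)"
      by (rule measurable_from_subalg[OF _ meas_mart[OF j]])
    then show ?thesis
      using meas_mart[OF j, of m] Suc by (simp add: sgn_mart_diff_def[abs_def])
  qed (simp add: sgn_mart_diff_def[abs_def])
  have bdd_diff: "ess_bounded ?P (sgn_mart_diff E m j)" if j: "j \<le> n" for m j
  proof -
    have "ess_bounded ?P (sgn_mart E m' j)" for m'
      unfolding sgn_mart_def[abs_def] using ess_bounded_signs[OF bddE[OF j]]
      by (cases "2 * j < m'") (simp_all add: ess_bounded_zero)
    then show ?thesis
      unfolding sgn_mart_diff_def[abs_def]
      by (cases m) (simp_all add: ess_bounded_zero ess_bounded_diff)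
  qed
  have ce_diff: "is_cond_exp ?P (G m) (sgn_mart_diff E (Suc m) j) (\<lambda>_. 0)" if j: "j \<le> n" for m j
  proof -
    have zero: "is_cond_exp ?P (G m) (\<lambda>_. 0 :: 'k) (\<lambda>_. 0)"
      by (simp add: is_cond_exp_def)
    obtain k where "m = 2 * k \<or> m = Suc (2 * k)" by (metis evenE oddE Suc_eq_plus1)
    then show ?thesis
    proof
      assume m: "m = 2 * k"
      show ?thesis
      proof (cases "j = k")
        case True
        then have eq: "sgn_mart_diff E (Suc m) j = (\<lambda>z. sgn_coord k (snd z) *\<^sub>R E k k (fst z))"
          by (simp add: fun_eq_iff m sgn_mart_diff_odd)
        have "integrable M (E k k)" using E[OF j] True by (simp add: is_cond_exp_def)
        then show ?thesis
          unfolding eq G_def using True j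
          by (intro is_cond_exp_signs[OF M.prob_space_axioms subB]) (simp_all add: m)
      next
        case False
        then have eq: "sgn_mart_diff E (Suc m) j = (\<lambda>_. 0)" by (simp add: fun_eq_iff m sgn_mart_diff_odd)
        then show ?thesis using zero by simp
      qed
    next
      assume m: "m = Suc (2 * k)"
      show ?thesis
      proof (cases "j \<le> k")
        case True
        then have eq: "sgn_mart_diff E (Suc m) j
            = (\<lambda>z. sgn_coord j (snd z) *\<^sub>R (\<lambda>x. E (Suc k) j x - E k j x) (fst z))"
          by (simp add: fun_eq_iff m sgn_mart_diff_even)
        have int: "integrable M (E l j)" for l using E[OF j] by (simp add: is_cond_exp_def)
        \<comment> \<open>D belongs to both sigma-algebras, so both conditional expectations have
          the integral of \<theta> j over D.\<close>
        have "set_lebesgue_integral M D (\<lambda>x. E (Suc k) j x - E k j x) = 0" if D: "D \<in> sets (B k)" for D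
        proof -
          have D': "D \<in> sets (B (Suc k))" using D monoB[of k "Suc k"] by auto
          have DM: "D \<in> sets M" using D subB[of k] by (auto simp: subalgebra_def)
          then have "set_integrable M D (E l j)" for l
            unfolding set_integrable_def using int by (rule integrable_mult_indicator)
          then have "set_lebesgue_integral M D (\<lambda>x. E (Suc k) j x - E k j x)
              = set_lebesgue_integral M D (E (Suc k) j) - set_lebesgue_integral M D (E k j)"
            by (intro set_integral_diff)
          also have "\<dots> = 0"
            using E[OF j, of "Suc k"] E[OF j, of k] D D' unfolding is_cond_exp_def by (metis diff_self)
          finally show ?thesis .
        qed
        then show ?thesis
          unfolding eq G_def
          by (intro is_cond_exp_signs[OF M.prob_space_axioms subB]) (simp_all add: m int j)
      next
        case False
        then have eq: "sgn_mart_diff E (Suc m) j = (\<lambda>_. 0)" by (simp add: fun_eq_iff m sgn_mart_diff_even)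
        then show ?thesis using zero by simp
      qed
    qed
  qed
  define J where "J = the_inv_into {..n} i"
  have J: "J w \<le> n" if "w \<in> i ` {..n}" for w
    unfolding J_def using the_inv_into_into[OF inj that subset_refl] by simp
  \<comment> \<open>The indices i_0, ..., i_n need not exhaust the words; the remaining coordinates
    are 0.\<close>
  define embed :: "(nat \<Rightarrow> 'k) \<Rightarrow> (bool \<times> bool) list \<Rightarrow> 'k"
    where "embed c w = (if w \<in> i ` {..n} then c (J w) else 0)" for c w
  have norm_S: "E_norm p q N (\<Sum>k\<le>n. E_scale (c k) (E_basis (i k))) = E_norm_fun p q N (embed c)" for c
  proof -
    have "(\<Sum>k\<le>n. E_scale (c k) (E_basis (i k))) = (\<Sum>w\<in>i ` {..n}. Poly_Mapping.single w (c (J w)))"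
      unfolding sum.reindex[OF inj] E_scale_basis J_def by (simp add: the_inv_into_f_f[OF inj])
    then show ?thesis
      unfolding E_norm_def by (intro E_norm_fun_cong_norm) (simp add: lookup_sum_single embed_def)
  qed
  define d where "d m w z = embed (\<lambda>j. sgn_mart_diff E m j z) w" for m w z
  define \<epsilon> :: "nat \<Rightarrow> real" where "\<epsilon> m = (if odd m then 1 else -1)" for m
  \<comment> \<open>At this time every sign is revealed and the half-time is n + 1, where
    \<open>E\<close> equals \<theta>.\<close>
  define L where "L = 2 * Suc n"
  have meas_d: "d m w \<in> borel_measurable (G m)" for m w
    unfolding d_def embed_def using meas_diff J by (cases "w \<in> i ` {..n}") simp_all
  have meas_dP: "d m w \<in> borel_measurable ?P" for m w
    using meas_d by (rule measurable_from_subalg[OF subG])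
  have bdd_d: "ess_bounded ?P (d m w)" for m w
    unfolding d_def embed_def using bdd_diff J by (cases "w \<in> i ` {..n}") (simp_all add: ess_bounded_zero)
  have ce_d: "is_cond_exp ?P (G m) (d (Suc m) w) (\<lambda>_. 0)" for m w
    unfolding d_def embed_def using ce_diff J
    by (cases "w \<in> i ` {..n}") (simp_all add: is_cond_exp_def)
  have fin_d: "Lnorm ?P (ennreal s) (\<lambda>z. E_norm_fun p q N (\<lambda>w. d m w z)) < \<infinity>" for m
  proof -
    obtain R where "AE z in ?P. norm (E_norm_fun p q N (\<lambda>w. d m w z)) \<le> R"
      using ess_bounded_E_norm_fun[of N ?P "d m" p q] bdd_d by (auto simp: ess_bounded_def)
    then have "AE z in ?P. \<bar>E_norm_fun p q N (\<lambda>w. d m w z)\<bar> \<le> max 0 R"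
      by eventually_elim auto
    from Lnorm_le_bound[OF P.prob_space_axioms s _ this] show ?thesis
      by (simp add: le_less_trans[OF _ ennreal_less_top])
  qed
  obtain h :: "'w \<times> nat set \<Rightarrow> 'w" where h: "inj_on h (UNIV \<times> Pow {..n})"
    using infinite_embeds_Times[OF inf, of "Pow {..n}"] by auto
  then have h: "inj_on h (space ?P)"
    by (rule inj_on_subset) (auto simp: space_pair_measure space_signs)
  define N1 where "N1 z = E_norm_fun p q N (\<lambda>w. \<Sum>m\<le>L. d m w z)" for z
  define N2 where "N2 z = E_norm_fun p q N (\<lambda>w. \<Sum>m\<le>L. \<epsilon> m *\<^sub>R d m w z)" for z
  have meas_N [measurable]: "N1 \<in> borel_measurable ?P" "N2 \<in> borel_measurable ?P"
    unfolding N1_def N2_def using meas_dP by (auto intro!: borel_measurable_E_norm_fun)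
  have transform: "Lnorm ?P (ennreal s) (\<lambda>z. E_norm_fun p q N (\<lambda>w. \<Sum>m\<le>L. e m *\<^sub>R d m w z))
      \<le> ennreal C * Lnorm ?P (ennreal s) N1" if "e \<in> UNIV \<rightarrow> {-1, 1}" for e
    unfolding N1_def
    by (rule umd_bound_coordinates[OF C h filtG meas_d fin_d ce_d that])
  \<comment> \<open>Constant signs put the factor C in front of the martingale itself, in place of a
    proof that C is at least 1.\<close>
  have N1_le: "Lnorm ?P (ennreal s) N1 \<le> ennreal C * Lnorm ?P (ennreal s) N1"
    using transform[of "\<lambda>_. 1"] by (simp add: N1_def[abs_def])
  have N2_le: "Lnorm ?P (ennreal s) N2 \<le> ennreal C * Lnorm ?P (ennreal s) N1"
    using transform[of \<epsilon>] by (auto simp: N2_def[abs_def] \<epsilon>_def)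
  \<comment> \<open>The final value has coordinates \<epsilon>_j \<theta>_j, and unconditionality
    removes the signs pointwise.\<close>
  have N1_eq: "N1 z = E_norm_fun p q N (embed (\<lambda>j. \<theta> j (fst z)))" for z
    unfolding N1_def
  proof (rule E_norm_fun_cong_norm)
    fix w :: "(bool \<times> bool) list"
    show "norm (\<Sum>m\<le>L. d m w z) = norm (embed (\<lambda>j. \<theta> j (fst z)) w)"
      using J[of w] by (cases "w \<in> i ` {..n}")
        (auto simp: d_def embed_def sum_sgn_mart_diff, auto simp: L_def sgn_mart_def E_def abs_sgn_coord)
  qed
  \<comment> \<open>The sum of the two expressions has coordinates 2 \<epsilon>_j g_j;
    unconditionality removes the signs again, and the triangle inequality gives the average.\<close>
  have odd_part: "E_norm_fun p q N (embed (\<lambda>j. g j (fst z))) \<le> (N1 z + N2 z) / 2" for z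
  proof -
    have "(\<Sum>m\<le>L. d m w z) + (\<Sum>m\<le>L. \<epsilon> m *\<^sub>R d m w z)
        = embed (\<lambda>j. 2 *\<^sub>R (sgn_coord j (snd z) *\<^sub>R g j (fst z))) w" for w
    proof (cases "w \<in> i ` {..n}")
      case True
      then show ?thesis
        using sum_sgn_mart_diff_alternating[where k = "Suc n" and E = E and j = "J w" and z = z] J[of w]
        by (simp add: d_def embed_def L_def \<epsilon>_def E_def sum.distrib)
    qed (simp add: d_def embed_def)
    then have "E_norm_fun p q N (\<lambda>w. (\<Sum>m\<le>L. d m w z) + (\<Sum>m\<le>L. \<epsilon> m *\<^sub>R d m w z))
        = E_norm_fun p q N (\<lambda>w. of_real 2 * embed (\<lambda>j. g j (fst z)) w)"
      by (intro E_norm_fun_cong_norm) (simp add: embed_def abs_sgn_coord abs_mult norm_mult)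
    also have "\<dots> = 2 * E_norm_fun p q N (embed (\<lambda>j. g j (fst z)))"
      by (simp only: E_norm_fun_scale[OF p q] norm_of_real abs_numeral)
    finally have eq: "E_norm_fun p q N (\<lambda>w. (\<Sum>m\<le>L. d m w z) + (\<Sum>m\<le>L. \<epsilon> m *\<^sub>R d m w z))
        = 2 * E_norm_fun p q N (embed (\<lambda>j. g j (fst z)))" .
    have "2 * E_norm_fun p q N (embed (\<lambda>j. g j (fst z))) \<le> N1 z + N2 z"
      unfolding N1_def N2_def eq[symmetric] by (rule E_norm_fun_triangle[OF p q])
    then show ?thesis by simp
  qed
  have meas_g: "(\<lambda>x. E_norm_fun p q N (embed (\<lambda>j. g j x))) \<in> borel_measurable M"
  proof (rule borel_measurable_E_norm_fun)
    fix w :: "(bool \<times> bool) list"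
    have "g (J w) \<in> borel_measurable M" if "w \<in> i ` {..n}"
      using \<theta> J[OF that] by (auto simp: is_cond_exp_def)
    then show "(\<lambda>x. embed (\<lambda>j. g j x) w) \<in> borel_measurable M"
      by (cases "w \<in> i ` {..n}") (simp_all add: embed_def)
  qed
  define H where "H x = E_norm_fun p q N (embed (\<lambda>j. \<theta> j x))" for x
  have N1_bound: "Lnorm ?P (ennreal s) N1 \<le> Lnorm M \<infinity> H"
  proof (cases "Lnorm M \<infinity> H")
    case (real R)
    have "AE x in M. ennreal \<bar>H x\<bar> \<le> ennreal R"
      using esssup_AE[of "\<lambda>x. ennreal \<bar>H x\<bar>" M] real by (simp add: Lnorm_def)
    then have "AE x in M. \<bar>H x\<bar> \<le> R" using real by simp
    then have "AE z in ?P. \<bar>N1 z\<bar> \<le> R" unfolding N1_eq H_def[symmetric] by (rule AE_fst_signs)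
    then show ?thesis using Lnorm_le_bound[OF P.prob_space_axioms s] real by simp
  qed simp
  have "Lnorm M 1 (\<lambda>x. E_norm_fun p q N (embed (\<lambda>j. g j x)))
      = (\<integral>\<^sup>+ z. ennreal (E_norm_fun p q N (embed (\<lambda>j. g j (fst z)))) \<partial>?P)"
  proof -
    have "Lnorm M 1 (\<lambda>x. E_norm_fun p q N (embed (\<lambda>j. g j x)))
        = (\<integral>\<^sup>+ x. ennreal (E_norm_fun p q N (embed (\<lambda>j. g j x))) \<partial>distr ?P M fst)"
      by (simp add: Lnorm_1 E_norm_fun_nonneg Q.distr_pair_fst)
    also have "\<dots> = (\<integral>\<^sup>+ z. ennreal (E_norm_fun p q N (embed (\<lambda>j. g j (fst z)))) \<partial>?P)"
      using meas_g by (intro nn_integral_distr) simp_all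
    finally show ?thesis .
  qed
  also have "\<dots> \<le> (\<integral>\<^sup>+ z. ennreal (1 / 2) * (ennreal \<bar>N1 z\<bar> + ennreal \<bar>N2 z\<bar>) \<partial>?P)"
  proof (intro nn_integral_mono)
    fix z
    have "0 \<le> N1 z" "0 \<le> N2 z" by (simp_all add: N1_def N2_def E_norm_fun_nonneg)
    then have le: "E_norm_fun p q N (embed (\<lambda>j. g j (fst z))) \<le> 1 / 2 * (\<bar>N1 z\<bar> + \<bar>N2 z\<bar>)"
      using odd_part[of z] by simp
    have "ennreal (1 / 2 * (\<bar>N1 z\<bar> + \<bar>N2 z\<bar>)) = ennreal (1 / 2) * (ennreal \<bar>N1 z\<bar> + ennreal \<bar>N2 z\<bar>)"
      by (subst ennreal_mult', simp, subst ennreal_plus) (simp_all only: abs_ge_zero)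
    then show "ennreal (E_norm_fun p q N (embed (\<lambda>j. g j (fst z))))
        \<le> ennreal (1 / 2) * (ennreal \<bar>N1 z\<bar> + ennreal \<bar>N2 z\<bar>)"
      using ennreal_leI[OF le] by (simp only:)
  qed
  also have "\<dots> = ennreal (1 / 2) * (Lnorm ?P 1 N1 + Lnorm ?P 1 N2)"
    by (simp add: Lnorm_1 nn_integral_cmult nn_integral_add)
  also have "\<dots> \<le> ennreal (1 / 2) * (ennreal C * Lnorm ?P (ennreal s) N1 + ennreal C * Lnorm ?P (ennreal s) N1)"
    by (intro mult_left_mono add_mono order_trans[OF Lnorm_1_le[OF P.prob_space_axioms s] N1_le]
        order_trans[OF Lnorm_1_le[OF P.prob_space_axioms s] N2_le]) simp_all
  also have "\<dots> = ennreal C * Lnorm ?P (ennreal s) N1"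
  proof -
    have "ennreal (1 / 2) * (x + x) = x" for x
    proof -
      have "ennreal (1 / 2) * (x + x) = (ennreal (1 / 2) + ennreal (1 / 2)) * x"
        by (simp only: distrib_left distrib_right)
      also have "ennreal (1 / 2) + ennreal (1 / 2) = 1"
        by (subst ennreal_plus[symmetric]) simp_all
      finally show ?thesis by simp
    qed
    then show ?thesis .
  qed
  also have "\<dots> \<le> ennreal C * Lnorm M \<infinity> H"
    using N1_bound by (intro mult_left_mono) simp_all
  finally show "Lnorm M 1 (\<lambda>w. E_norm p q N (\<Sum>k\<le>n. E_scale (g k w) (E_basis (i k))))
      \<le> ennreal C * Lnorm M \<infinity> (\<lambda>w. E_norm p q N (\<Sum>k\<le>n. E_scale (\<theta> k w) (E_basis (i k))))"
    unfolding norm_S H_def .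
qed

text \<open>Every C admissible for UMD is admissible for S, so the second infimum runs over a larger
  set.\<close>

lemma E_S_le_E_umd:
  fixes K :: "'k::{real_normed_field, euclidean_space} itself" and W :: "'w itself"
  assumes "1 \<le> p" "1 \<le> q" "1 < s" "infinite (UNIV :: 'w set)"
  shows "E_S W K p q n \<le> E_umd W K p q n s"
  unfolding E_S_def E_umd_def S_const_eq umd_const_eq
  using umd_bound_imp_S_bound[OF assms, of W n] by (intro Inf_superset_mono) auto

theorem theorem3p10:
  fixes p q :: ennreal
    and K :: "'k::{real_normed_field, euclidean_space} itself"
    and W :: "'w itself"
  assumes "1 \<le> p" and "1 \<le> q"
    and "infinite (UNIV :: 'w set)"
  shows "(\<forall>s>1. \<forall>n\<ge>1. E_umd W K p q n s \<ge> E_S W K p q n \<and>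
                      E_S W K p q n \<ge> c_const K p q ^ n)
    \<and> (p \<noteq> q \<longrightarrow> c_const K p q > 1 \<and>
         (\<exists>a::real>1. \<forall>s>1. \<forall>n\<ge>1. E_umd W K p q n s \<ge> ennreal (a ^ n)))"
proof (intro conjI impI)
  show main: "\<forall>s>1. \<forall>n\<ge>1. E_umd W K p q n s \<ge> E_S W K p q n \<and> E_S W K p q n \<ge> c_const K p q ^ n"
    using E_S_le_E_umd[OF assms(1,2) _ assms(3)] c_const_power_le_E_S[OF assms] by blast
  assume "p \<noteq> q"
  then obtain a :: real where a: "1 < a" "ennreal a \<le> c_const K p q"
    using c_const_gt_1[OF assms(1,2)] by blast
  show "c_const K p q > 1"
    using a by (metis ennreal_1 ennreal_less_iff less_le_trans zero_le_one)
  have "ennreal (a ^ n) \<le> E_umd W K p q n s" if "1 < s" "1 \<le> n" for s n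
  proof -
    have "ennreal (a ^ n) \<le> c_const K p q ^ n"
      using a power_mono[OF a(2), of n] by (simp add: ennreal_power)
    then show ?thesis using main that by (meson order_trans)
  qed
  then show "\<exists>a::real>1. \<forall>s>1. \<forall>n\<ge>1. E_umd W K p q n s \<ge> ennreal (a ^ n)"
    using a(1) by blast
qed

end
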